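(* Let $H_1,H_2,H_3$ be the 3-graphs on vertex set $\{1,2,3,4,5\}$ with edge sets $E(H_1)=\{123,124,134,234,125,345\}$, $E(H_2)=\{123,124,134,234,135,145,235,245\}$, $E(H_3)=\{123,124,134,234,125,135,145,235,245\}$, and let $I^3_4$ be the 3-graph on 4 vertices with no edges. Then $$\pi_{\min}(I^3_4,H_1,H_2,H_3)=\frac49 .$$
   Context: A 3-graph is a 3-uniform hypergraph. For a finite family $\mathcal H$ of 3-graphs and an integer $n$, $\mathrm{ex}_{\min}(n;\mathcal H)$ denotes the minimal possible number of edges in an $n$-vertex 3-graph containing no member of $\mathcal H$ as an induced subgraph, and $\pi_{\min}(\mathcal H)=\lim_{n\to\infty}\mathrm{ex}_{\min}(n;\mathcal H)/\binom n3$ (this limit exists). *)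

theory Defs
  imports Complex_Main
begin

text \<open>A hypergraph is a pair (vertex set, edge set).\<close>

type_synonym 'a hypergraph = "'a set \<times> 'a set set"

definition verts :: "'a hypergraph \<Rightarrow> 'a set" where
  "verts G = fst G"

definition edges :: "'a hypergraph \<Rightarrow> 'a set set" where
  "edges G = snd G"

definition three_graph :: "'a hypergraph \<Rightarrow> bool" where
  "three_graph G \<longleftrightarrow> finite (verts G) \<and> (\<forall>e\<in>edges G. e \<subseteq> verts G \<and> card e = 3)"

definition induced_subgraph :: "'a hypergraph \<Rightarrow> 'a set \<Rightarrow> 'a hypergraph" where
  "induced_subgraph G S = (S, {e \<in> edges G. e \<subseteq> S})"

definition isomorphic :: "'a hypergraph \<Rightarrow> 'b hypergraph \<Rightarrow> bool" where
  "isomorphic G H \<longleftrightarrow>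
     (\<exists>f. bij_betw f (verts G) (verts H) \<and> edges H = (\<lambda>e. f ` e) ` edges G)"

definition contains_induced :: "'a hypergraph \<Rightarrow> 'b hypergraph \<Rightarrow> bool" where
  "contains_induced G H \<longleftrightarrow> (\<exists>S\<subseteq>verts G. isomorphic (induced_subgraph G S) H)"

definition induced_free :: "'b hypergraph set \<Rightarrow> 'a hypergraph \<Rightarrow> bool" where
  "induced_free \<H> G \<longleftrightarrow> (\<forall>H\<in>\<H>. \<not> contains_induced G H)"

text \<open>
  Every n-vertex 3-graph is isomorphic to one on the vertex set {1..n}, so the minimum is
  taken over those. The set below is finite. If it is empty (which is possible only when
  every n-vertex 3-graph contains a member of the family), the value is unspecified.
\<close>

definition ex_min :: "nat \<Rightarrow> 'b hypergraph set \<Rightarrow> nat" where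
  "ex_min n \<H> = Min {card (edges G) | G :: nat hypergraph.
     three_graph G \<and> verts G = {1..n} \<and> induced_free \<H> G}"

definition min_density :: "'b hypergraph set \<Rightarrow> nat \<Rightarrow> real" where
  "min_density \<H> n = real (ex_min n \<H>) / real (n choose 3)"

definition pi_min :: "'b hypergraph set \<Rightarrow> real" where
  "pi_min \<H> = lim (min_density \<H>)"

definition I34 :: "nat hypergraph" where
  "I34 = ({1,2,3,4}, {})"

definition H1 :: "nat hypergraph" where
  "H1 = ({1,2,3,4,5},
     {{1,2,3}, {1,2,4}, {1,3,4}, {2,3,4}, {1,2,5}, {3,4,5}})"

definition H2 :: "nat hypergraph" where
  "H2 = ({1,2,3,4,5},
     {{1,2,3}, {1,2,4}, {1,3,4}, {2,3,4}, {1,3,5}, {1,4,5}, {2,3,5}, {2,4,5}})"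

definition H3 :: "nat hypergraph" where
  "H3 = ({1,2,3,4,5},
     {{1,2,3}, {1,2,4}, {1,3,4}, {2,3,4}, {1,2,5}, {1,3,5}, {1,4,5}, {2,3,5}, {2,4,5}})"

end

theory Submission
  imports Defs "HOL-Library.FuncSet" "HOL-Library.Ramsey" "HOL-Real_Asymp.Real_Asymp"
begin

text \<open>
  For the lower bound, suppose that a large 3-graph G is sparser than 4/9. Then a positive
  proportion of the N-tuples of vertices span few edges, so by Erdos's theorem on complete
  N-partite subgraphs there is a box of such tuples, and Ramsey's theorem yields two clones of each
  of N vertices such that adjacency does not depend on the choice of the clone. Writing
  "out i j" if two clones of i together with a clone of j form a non-edge, the absence of
  independent 4-sets makes this an oriented graph without induced directed 4-cycles in which every vertex
  together with any two of its out-neighbours spans an edge, and the absence of H1, H2, H3 makes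
  non-adjacency an equivalence relation whose classes are cliques of G. Hence, with a(i) the class size
  and d(i) the out-degree, the number of ordered edges is, up to lower order terms, at least the sum of
  a(i)^2 + 3 d(i)^2. Since the sum of 2 d(i) + a(i) is N^2, this is at least 4/9 N^3 by
  convexity, unless there are two classes larger than N/3; between these the
  out-neighbourhoods are nested, and the resulting variance of d compensates.
\<close>

text \<open>Pairs of clones make non-adjacency useful. If no arc joins i and j, their four clones
  span a complete 4-vertex graph. In the link of a clone of k on it, the four cross pairs are all
  present or all absent, and each inner pair records whether i or j sends an arc to k.
  \<open>H1\<close> forbids both inner pairs without cross pairs; \<open>H2\<close> and
  \<open>H3\<close> forbid the cross pairs with at most one inner pair. So ijk is an edge exactly
  when neither i nor j sends an arc to k. Transitivity, the cliques and the exclusion of 4-cycles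
  all come from this equivalence. Ramsey's theorem alone would lose the low density; the box keeps
  it, since every choice from it is a sparse tuple. Minimising a^2 + 3d^2 under 2d + a = N = 3M
  would ask for classes of size 9M/7, which cannot add up to 3M. The proof must therefore use that
  the sizes are those of a partition, and a cubic with zeros 0, M, 2M does so. The upper bound is
  Turan's construction, where 12 of 27 residue patterns are edges.\<close>

section \<open>Oriented complete multipartite graphs without induced directed 4-cycles\<close>

text \<open>
  Summed over the classes of a graph on 3M vertices, this is the surplus of the sum of squares in
  sum_squares_ge beyond its lower bound, apart from the variance of the out-degrees. It is
  negative only for M < t < 2M, so at most two classes contribute negatively.
\<close>

definition turan_cubic :: "int \<Rightarrow> int \<Rightarrow> int" where
  "turan_cubic M t = t * (t - M) * (t - 2 * M)"

lemma turan_cubic_nonneg: "0 \<le> t \<Longrightarrow> t \<le> M \<Longrightarrow> 0 \<le> turan_cubic M t"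
  unfolding turan_cubic_def by (intro mult_nonpos_nonpos mult_nonneg_nonpos) auto

text \<open>\<open>turan_cubic M\<close> is concave on [0, M] and vanishes at both ends. Moving two
  sizes apart with fixed sum, until the smaller is 0 or the larger is M, therefore cannot increase
  the sum of the values.\<close>

lemma turan_cubic_merge:
  assumes "0 \<le> a" "a \<le> M" "0 \<le> b" "b \<le> M"
  shows "a + b \<le> M \<Longrightarrow> turan_cubic M (a + b) \<le> turan_cubic M a + turan_cubic M b"
    and "M \<le> a + b \<Longrightarrow> turan_cubic M (a + b - M) \<le> turan_cubic M a + turan_cubic M b"
proof -
  assume "a + b \<le> M"
  then have "0 \<le> 3 * ((a * b) * (2 * M - a - b))"
    using assms by (intro mult_nonneg_nonneg) auto
  also have "\<dots> = turan_cubic M a + turan_cubic M b - turan_cubic M (a + b)"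
    by (simp add: turan_cubic_def algebra_simps)
  finally show "turan_cubic M (a + b) \<le> turan_cubic M a + turan_cubic M b" by simp
next
  have "0 \<le> 3 * (((M - a) * (M - b)) * (2 * M - a - b))"
    using assms by (intro mult_nonneg_nonneg) auto
  also have "\<dots> = turan_cubic M a + turan_cubic M b - turan_cubic M (a + b - M)"
    by (simp add: turan_cubic_def algebra_simps)
  finally show "turan_cubic M (a + b - M) \<le> turan_cubic M a + turan_cubic M b" by simp
qed

text \<open>
  Classes of size at most M are merged, dropping a block of size M (which costs nothing)
  whenever the total exceeds M.
\<close>

lemma turan_cubic_merge_sum:
  assumes "finite Q" "0 < M" "\<And>A. A \<in> Q \<Longrightarrow> 0 \<le> w A \<and> w A \<le> M"
  shows "\<exists>k r. 0 \<le> k \<and> 0 \<le> r \<and> r \<le> M \<and> sum w Q = k * M + r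
           \<and> turan_cubic M r \<le> (\<Sum>A\<in>Q. turan_cubic M (w A))"
  using assms(1,3)
proof (induction Q rule: finite_induct)
  case empty
  show ?case using \<open>0 < M\<close> by (intro exI[of _ 0]) (auto simp: turan_cubic_def)
next
  case (insert A Q)
  then obtain k r where k: "0 \<le> k" "0 \<le> r" "r \<le> M" "sum w Q = k * M + r"
    and r: "turan_cubic M r \<le> (\<Sum>A\<in>Q. turan_cubic M (w A))"
    by (metis insertCI)
  have w: "0 \<le> w A" "w A \<le> M" using insert.prems by auto
  show ?case
  proof (cases "w A + r \<le> M")
    case True
    then show ?thesis
      using turan_cubic_merge(1)[OF w k(2,3) True] k r w insert.hyps
      by (intro exI[of _ k] exI[of _ "w A + r"]) auto
  next
    case False
    then show ?thesis
      using turan_cubic_merge(2)[OF w k(2,3)] k r w insert.hyps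
      by (intro exI[of _ "k + 1"] exI[of _ "w A + r - M"]) (auto simp: algebra_simps)
  qed
qed

text \<open>Layer counting: the square of a deficit z - f a is the sum of 2(z - s) + 1 over f a < s
  \<le> z, and by hypothesis layer s has at least s elements. The bound is 1^2 + ... + z^2, as if
  the deficits were 1, ..., z.\<close>

lemma sum_deficit_squares:
  fixes f :: "'a \<Rightarrow> nat" and h :: "'b \<Rightarrow> nat"
  assumes "finite A" "finite B"
    and "\<And>s. s \<le> z \<Longrightarrow> s \<le> card {a\<in>A. f a < s} + card {b\<in>B. h b < s}"
  shows "z * (z + 1) * (2 * z + 1) \<le> 6 * ((\<Sum>a\<in>A. (z - f a)\<^sup>2) + (\<Sum>b\<in>B. (z - h b)\<^sup>2))"
proof -
  have step: "(\<Sum>a\<in>C. Suc z - g a) = (\<Sum>a\<in>C. z - g a) + card {a\<in>C. g a < Suc z}"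
    "(\<Sum>a\<in>C. (Suc z - g a)\<^sup>2) =
       (\<Sum>a\<in>C. (z - g a)\<^sup>2) + 2 * (\<Sum>a\<in>C. z - g a) + card {a\<in>C. g a < Suc z}"
    if "finite C" for C :: "'c set" and g :: "'c \<Rightarrow> nat" and z
  proof -
    have c: "card {a\<in>C. g a < Suc z} = (\<Sum>a\<in>C. if g a < Suc z then 1 else 0)"
      using that by (simp add: sum.If_cases Int_def)
    show "(\<Sum>a\<in>C. Suc z - g a) = (\<Sum>a\<in>C. z - g a) + card {a\<in>C. g a < Suc z}"
      unfolding c sum.distrib[symmetric] by (intro sum.cong) auto
    show "(\<Sum>a\<in>C. (Suc z - g a)\<^sup>2) =
       (\<Sum>a\<in>C. (z - g a)\<^sup>2) + 2 * (\<Sum>a\<in>C. z - g a) + card {a\<in>C. g a < Suc z}"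
      unfolding c sum_distrib_left sum.distrib[symmetric]
    proof (intro sum.cong refl)
      fix a
      show "(Suc z - g a)\<^sup>2 = (z - g a)\<^sup>2 + 2 * (z - g a) + (if g a < Suc z then 1 else 0)"
      proof (cases "g a \<le> z")
        case True
        then obtain d where "z = g a + d" using le_Suc_ex by blast
        then show ?thesis by (simp add: power2_eq_square)
      qed auto
    qed
  qed
  \<comment> \<open>Besides the new layer, raising z by one adds twice the linear deficits to the
    squares, so the induction carries bounds for both.\<close>
  have "z * (z + 1) \<le> 2 * ((\<Sum>a\<in>A. z - f a) + (\<Sum>b\<in>B. z - h b)) \<and> ?thesis"
    using assms(3)
  proof (induction z)
    case (Suc z)
    have arith: "p + 2 * Suc z \<le> 2 * (T + c + (T' + c')) \<and>
        q + 6 * p + 6 * Suc z \<le> 6 * (S + 2 * T + c + (S' + 2 * T' + c'))"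
      if "p \<le> 2 * (T + T')" "q \<le> 6 * (S + S')" "Suc z \<le> c + c'" for p q T T' S S' c c'
      using that by auto
    have "Suc z * (Suc z + 1) = z * (z + 1) + 2 * Suc z"
      "Suc z * (Suc z + 1) * (2 * Suc z + 1) =
        z * (z + 1) * (2 * z + 1) + 6 * (z * (z + 1)) + 6 * Suc z"
      by (simp_all add: algebra_simps)
    moreover have "z * (z + 1) \<le> 2 * ((\<Sum>a\<in>A. z - f a) + (\<Sum>b\<in>B. z - h b))"
      "z * (z + 1) * (2 * z + 1) \<le> 6 * ((\<Sum>a\<in>A. (z - f a)\<^sup>2) + (\<Sum>b\<in>B. (z - h b)\<^sup>2))"
      using Suc by simp_all
    ultimately show ?case
      unfolding step[OF assms(1)] step[OF assms(2)]
      by (simp only:) (intro arith Suc.prems order_refl)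
  qed simp
  then show ?thesis by simp
qed

text \<open>\<open>nonadj_trans\<close> concludes only one direction; the other follows by
  exchanging i and k. \<open>asym\<close> with i = j excludes loops, so each vertex lies in its own
  class.\<close>

locale oriented_multipartite =
  fixes I :: "'a set" and out :: "'a \<Rightarrow> 'a \<Rightarrow> bool"
  assumes finite_I: "finite I"
    and asym: "i \<in> I \<Longrightarrow> j \<in> I \<Longrightarrow> out i j \<Longrightarrow> \<not> out j i"
    and nonadj_trans: "i \<in> I \<Longrightarrow> j \<in> I \<Longrightarrow> k \<in> I \<Longrightarrow> \<not> out i j \<Longrightarrow> \<not> out j i \<Longrightarrow>
      \<not> out j k \<Longrightarrow> \<not> out k j \<Longrightarrow> \<not> out i k"
    and no_induced_C4: "i \<in> I \<Longrightarrow> j \<in> I \<Longrightarrow> k \<in> I \<Longrightarrow> l \<in> I \<Longrightarrow>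
      out i j \<Longrightarrow> out j k \<Longrightarrow> out k l \<Longrightarrow> out l i \<Longrightarrow>
      out i k \<or> out k i \<or> out j l \<or> out l j"
begin

definition cls :: "'a \<Rightarrow> 'a set" where
  "cls i = {j\<in>I. \<not> out i j \<and> \<not> out j i}"

definition outdeg :: "'a \<Rightarrow> nat" where
  "outdeg i = card {j\<in>I. out i j}"

section \<open>The classes of non-adjacency as a partition\<close>

lemma irrefl: "i \<in> I \<Longrightarrow> \<not> out i i"
  using asym by blast

lemma cls_self: "i \<in> I \<Longrightarrow> i \<in> cls i"
  by (auto simp: cls_def irrefl)

lemma cls_eqI:
  assumes "i \<in> I" "j \<in> cls i"
  shows "cls j = cls i"
proof -
  have "j \<in> I" "\<not> out i j" "\<not> out j i" using assms by (auto simp: cls_def)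
  then have "\<not> out i k \<and> \<not> out k i \<longleftrightarrow> \<not> out j k \<and> \<not> out k j" if "k \<in> I" for k
    using nonadj_trans[of i j k] nonadj_trans[of k j i] nonadj_trans[of j i k]
      nonadj_trans[of k i j] assms(1) that by blast
  then show ?thesis by (auto simp: cls_def)
qed

lemma finite_cls: "finite (cls i)"
  using finite_I by (simp add: cls_def)

lemma cls_subset: "cls i \<subseteq> I"
  by (auto simp: cls_def)

lemma cls_disjoint:
  assumes "i \<in> I" "j \<in> I" "cls i \<noteq> cls j"
  shows "cls i \<inter> cls j = {}"
proof (rule ccontr)
  assume "cls i \<inter> cls j \<noteq> {}"
  then obtain k where "k \<in> cls i" "k \<in> cls j" by blast
  then show False using cls_eqI[of i k] cls_eqI[of j k] assms by simp
qed

lemma nonadj_in_cls: "i \<in> I \<Longrightarrow> a \<in> cls i \<Longrightarrow> b \<in> cls i \<Longrightarrow> \<not> out a b"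
  using cls_eqI[of i a] unfolding cls_def by auto

lemma adj_between_cls:
  assumes "i \<in> I" "j \<in> I" "cls i \<noteq> cls j" "a \<in> cls i" "b \<in> cls j"
  shows "out a b \<or> out b a"
proof (rule ccontr)
  assume "\<not> ?thesis"
  moreover have "a \<in> I" "b \<in> I" using assms cls_subset by auto
  ultimately have "b \<in> cls a" by (simp add: cls_def)
  then show False using cls_eqI[of i a] cls_disjoint[OF assms(1-3)] assms by auto
qed

text \<open>The factor \<open>card A\<close> gained by grouping vertices into classes is what turns
  (t - M)(t - 2M) into \<open>turan_cubic M t\<close>.\<close>

lemma sum_cls: "(\<Sum>i\<in>I. F (card (cls i))) = (\<Sum>A\<in>cls ` I. of_nat (card A) * (F (card A) :: int))"
proof -
  have I: "\<Union>(cls ` I) = I" using cls_self cls_subset by blast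
  have "(\<Sum>i\<in>I. F (card (cls i))) = (\<Sum>i\<in>\<Union>(cls ` I). F (card (cls i)))" by (simp only: I)
  also have "\<dots> = (\<Sum>A\<in>cls ` I. \<Sum>i\<in>A. F (card (cls i)))"
    using finite_cls cls_disjoint by (subst sum.Union_disjoint) auto
  also have "\<dots> = (\<Sum>A\<in>cls ` I. \<Sum>i\<in>A. F (card A))"
    by (intro sum.cong refl) (auto dest: cls_eqI)
  finally show ?thesis by simp
qed

lemma sum_outdeg: "2 * (\<Sum>i\<in>I. outdeg i) + (\<Sum>i\<in>I. card (cls i)) = card I * card I"
proof -
  have "card I = outdeg i + card {j\<in>I. out j i} + card (cls i)" if "i \<in> I" for i
  proof -
    have "I = {j\<in>I. out i j} \<union> {j\<in>I. out j i} \<union> cls i" by (auto simp: cls_def)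
    also have "card \<dots> = card ({j\<in>I. out i j} \<union> {j\<in>I. out j i}) + card (cls i)"
      using finite_I by (intro card_Un_disjoint) (auto simp: cls_def)
    also have "card ({j\<in>I. out i j} \<union> {j\<in>I. out j i}) = outdeg i + card {j\<in>I. out j i}"
      unfolding outdeg_def using finite_I asym[OF that] by (intro card_Un_disjoint) auto
    finally show ?thesis .
  qed
  then have "(\<Sum>i\<in>I. card I) = (\<Sum>i\<in>I. outdeg i + card {j\<in>I. out j i} + card (cls i))"
    by (rule sum.cong[OF refl])
  then have "card I * card I = (\<Sum>i\<in>I. outdeg i + card {j\<in>I. out j i} + card (cls i))"
    by (simp only: sum_constant of_nat_id)
  moreover have "(\<Sum>i\<in>I. card {j\<in>I. out j i}) = (\<Sum>i\<in>I. outdeg i)"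
    unfolding outdeg_def by (rule sum_multicount_gen) (use finite_I in auto)
  ultimately show ?thesis by (simp add: sum.distrib)
qed

text \<open>If a reaches b but not b', and a' reaches b' but not b, then a, b, a', b' is a directed
  4-cycle whose diagonals lie inside classes. Hence the out-neighbourhoods in \<open>cls j\<close>
  form a chain, ordered by size.\<close>

lemma out_nested:
  assumes "i \<in> I" "j \<in> I" "cls i \<noteq> cls j" "a \<in> cls i" "a' \<in> cls i"
    and le: "card {b\<in>cls j. out a b} \<le> card {b\<in>cls j. out a' b}"
    and b: "b \<in> cls j" "out a b"
  shows "out a' b"
proof (rule ccontr)
  assume nb: "\<not> out a' b"
  have sub: "{b\<in>cls j. out a' b} \<subseteq> {b\<in>cls j. out a b}"
  proof safe
    fix b' assume b': "b' \<in> cls j" "out a' b'"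
    show "out a b'"
    proof (rule ccontr)
      assume "\<not> out a b'"
      then have "out b' a" using adj_between_cls[of i j a b'] assms b' by simp
      moreover have "out b a'" using adj_between_cls[of i j a' b] assms nb by simp
      moreover have "a \<in> I" "a' \<in> I" "b \<in> I" "b' \<in> I" using assms b' cls_subset by auto
      moreover have "\<not> out a a'" "\<not> out a' a" using nonadj_in_cls[of i] assms by simp_all
      moreover have "\<not> out b b'" "\<not> out b' b" using nonadj_in_cls[of j] assms b' by simp_all
      ultimately show False using no_induced_C4[of a b a' b'] b b' by simp
    qed
  qed
  moreover have "b \<in> {b\<in>cls j. out a b}" "b \<notin> {b\<in>cls j. out a' b}" using b nb by simp_all
  ultimately have "{b\<in>cls j. out a' b} \<subset> {b\<in>cls j. out a b}" by (metis psubsetI)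
  moreover have "finite {b\<in>cls j. out a b}" using finite_cls by simp
  ultimately show False using psubset_card_mono le leD by blast
qed

text \<open>
  Take the vertex a with fewest out-neighbours among those with at least s of them, and b likewise
  on the other side. By nestedness, whichever way the arc between a and b points, its head
  receives arcs from all such vertices on the opposite side.
\<close>

lemma few_out_between_cls:
  assumes ij: "i \<in> I" "j \<in> I" "cls i \<noteq> cls j" and s: "s \<le> card (cls i)" "s \<le> card (cls j)"
  shows "s \<le> card {a\<in>cls i. card {b\<in>cls j. out a b} < s}
           + card {b\<in>cls j. card {a\<in>cls i. out b a} < s}"
proof (rule ccontr)
  define f h where "f a = card {b\<in>cls j. out a b}" and "h b = card {a\<in>cls i. out b a}" for a b
  define A B where "A = {a\<in>cls i. s \<le> f a}" and "B = {b\<in>cls j. s \<le> h b}"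
  assume "\<not> ?thesis"
  then have lt: "card (cls i - A) < s" "card (cls j - B) < s"
    by (auto simp: A_def B_def f_def h_def set_diff_eq not_le cong: conj_cong)
  have "A \<noteq> {}" "B \<noteq> {}" using lt s by auto
  then obtain a b where a: "is_arg_min f (\<lambda>x. x \<in> A) a" and b: "is_arg_min h (\<lambda>x. x \<in> B) b"
    using ex_is_arg_min_if_finite[of A f] ex_is_arg_min_if_finite[of B h] finite_cls
    unfolding A_def B_def by auto
  have aA: "a \<in> A" "b \<in> B" "a \<in> cls i" "b \<in> cls j" "s \<le> f a" "s \<le> h b"
    using a b by (auto simp: is_arg_min_def A_def B_def)
  show False
  proof (cases "out a b")
    case True
    have "out a' b" if "a' \<in> A" for a'
      using out_nested[OF ij, of a a' b] True that aA a
      by (auto simp: is_arg_min_def not_less f_def A_def)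
    then have "{a\<in>cls i. out b a} \<subseteq> cls i - A"
      using asym aA cls_subset by blast
    then have "h b \<le> card (cls i - A)" unfolding h_def using finite_cls by (intro card_mono) auto
    then show False using lt aA by simp
  next
    case False
    then have ba: "out b a" using adj_between_cls ij aA by blast
    have "out b' a" if "b' \<in> B" for b'
      using out_nested[OF ij(2,1), of b b' a] ij(3) ba that aA b
      by (auto simp: is_arg_min_def not_less h_def B_def)
    then have "{b\<in>cls j. out a b} \<subseteq> cls j - B"
      using asym aA cls_subset by blast
    then have "f a \<le> card (cls j - B)" unfolding f_def using finite_cls by (intro card_mono) auto
    then show False using lt aA by simp
  qed
qed

section \<open>Out-degrees in the presence of two large classes\<close>

lemma outdeg_le:
  assumes "i \<in> I" "j \<in> I" "cls i \<noteq> cls j" "a \<in> cls i"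
  shows "outdeg a + card (cls i) + card (cls j) \<le> card I + card {b\<in>cls j. out a b}"
proof -
  have "{j\<in>I. out a j} \<subseteq> (I - cls i - cls j) \<union> {b\<in>cls j. out a b}"
    using assms nonadj_in_cls by blast
  then have "outdeg a \<le> card ((I - cls i - cls j) \<union> {b\<in>cls j. out a b})"
    unfolding outdeg_def using finite_I finite_cls by (intro card_mono) auto
  also have "\<dots> \<le> card (I - cls i - cls j) + card {b\<in>cls j. out a b}"
    by (rule card_Un_le)
  also have "card (I - cls i - cls j) = card I - card (cls i) - card (cls j)"
    using cls_subset cls_disjoint[OF assms(1-3)] finite_cls
    by (subst card_Diff_subset card_Diff_subset; auto)+
  moreover have "card (cls i) + card (cls j) \<le> card I"
    using card_Un_disjoint[of "cls i" "cls j"] card_mono[of I "cls i \<union> cls j"]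
      finite_cls cls_disjoint[OF assms(1-3)] cls_subset finite_I by auto
  ultimately show ?thesis by linarith
qed

text \<open>Outside the two classes there are M - z vertices, so a vertex of one class with f
  out-neighbours in the other has out-degree at most M - (z - f). For each s \<le> z,
  \<open>few_out_between_cls\<close> supplies s vertices with f < s, and
  \<open>sum_deficit_squares\<close> adds up the squares.\<close>

lemma sum_outdeg_deviation:
  assumes ij: "i \<in> I" "j \<in> I" "cls i \<noteq> cls j" and I: "card I = 3 * M"
    and z: "z + 2 * M = card (cls i) + card (cls j)"
    and big: "M < card (cls i)" "M < card (cls j)"
  shows "int (z * (z + 1) * (2 * z + 1)) \<le> 6 * (\<Sum>i\<in>I. (int (outdeg i) - int M)\<^sup>2)"
proof -
  let ?f = "\<lambda>a. card {b\<in>cls j. out a b}" and ?h = "\<lambda>b. card {a\<in>cls i. out b a}"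
  have "card (cls i) + card (cls j) \<le> card I"
    using card_Un_disjoint[of "cls i" "cls j"] card_mono[of I "cls i \<union> cls j"]
      finite_cls cls_disjoint[OF ij] cls_subset finite_I by auto
  then have "z \<le> M" using I z by simp
  \<comment> \<open>The truncated \<open>z - y\<close> is 0 for y \<ge> z, where the inequality is
    trivial.\<close>
  have dev: "int ((z - y)\<^sup>2) \<le> (int (outdeg a) - int M)\<^sup>2" if "outdeg a + z \<le> M + y" for a y
  proof -
    have "int (z - y) \<le> \<bar>int (outdeg a) - int M\<bar>" using that by linarith
    then show ?thesis using abs_le_square_iff[of "int (z - y)" "int (outdeg a) - int M"] by simp
  qed
  have "z * (z + 1) * (2 * z + 1) \<le>
      6 * ((\<Sum>a\<in>cls i. (z - ?f a)\<^sup>2) + (\<Sum>b\<in>cls j. (z - ?h b)\<^sup>2))"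
    using few_out_between_cls[OF ij] big \<open>z \<le> M\<close> finite_cls
    by (intro sum_deficit_squares) auto
  then have le: "int (z * (z + 1) * (2 * z + 1)) \<le>
      6 * ((\<Sum>a\<in>cls i. int ((z - ?f a)\<^sup>2)) + (\<Sum>b\<in>cls j. int ((z - ?h b)\<^sup>2)))"
    by (simp only: of_nat_add of_nat_mult of_nat_numeral of_nat_sum flip: of_nat_le_iff[where 'a = int])
  have "(\<Sum>a\<in>cls i. int ((z - ?f a)\<^sup>2)) + (\<Sum>b\<in>cls j. int ((z - ?h b)\<^sup>2))
      \<le> (\<Sum>a\<in>cls i. (int (outdeg a) - int M)\<^sup>2) + (\<Sum>b\<in>cls j. (int (outdeg b) - int M)\<^sup>2)"
  proof (rule add_mono; rule sum_mono; rule dev)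
    show "outdeg a + z \<le> M + ?f a" if "a \<in> cls i" for a
      using outdeg_le[OF ij that] I z by linarith
    show "outdeg b + z \<le> M + ?h b" if "b \<in> cls j" for b
      using outdeg_le[OF ij(2,1) ij(3)[symmetric] that] I z by linarith
  qed
  also have "\<dots> = (\<Sum>a\<in>cls i \<union> cls j. (int (outdeg a) - int M)\<^sup>2)"
    using finite_cls cls_disjoint[OF ij] by (simp add: sum.union_disjoint)
  also have "\<dots> \<le> (\<Sum>i\<in>I. (int (outdeg i) - int M)\<^sup>2)"
    using cls_subset finite_I by (intro sum_mono2) auto
  finally show ?thesis by (rule order_trans[OF le mult_left_mono]) simp
qed

text \<open>Equality holds for three classes of size M with all out-degrees M, the pattern of the
  extremal construction; 12 M^3 is 4/9 of (3M)^3.\<close>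

lemma sum_squares_ge:
  assumes I: "card I = 3 * M" and "0 < M"
  shows "12 * M ^ 3 \<le> (\<Sum>i\<in>I. (card (cls i))\<^sup>2 + 3 * (outdeg i)\<^sup>2)"
proof -
  let ?g = "turan_cubic (int M)" and ?P = "cls ` I" and ?w = "\<lambda>A. int (card A)"
  let ?dev = "\<Sum>i\<in>I. (int (outdeg i) - int M)\<^sup>2"
  have finP: "finite ?P" using finite_I by simp
  have sumw: "(\<Sum>A\<in>?P. ?w A) = 3 * int M" using sum_cls[of "\<lambda>_. 1"] I by simp
  \<comment> \<open>\<open>S\<close> will consist of the classes larger than M. All others are
    replaced by one class of size r and k classes of size M, whose cubic is 0.\<close>
  have merge: "\<exists>k r. 0 \<le> k \<and> 0 \<le> r \<and> r \<le> int M \<and> 3 * int M - sum ?w S = k * int M + r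
           \<and> ?g r + (\<Sum>A\<in>S. ?g (?w A)) \<le> (\<Sum>A\<in>?P. ?g (?w A))"
    if "S \<subseteq> ?P" "\<And>A. A \<in> ?P - S \<Longrightarrow> card A \<le> M" for S
  proof -
    have "\<exists>k r. 0 \<le> k \<and> 0 \<le> r \<and> r \<le> int M \<and> sum ?w (?P - S) = k * int M + r
        \<and> ?g r \<le> (\<Sum>A\<in>?P - S. ?g (?w A))"
      by (rule turan_cubic_merge_sum) (use that(2) \<open>0 < M\<close> finP in auto)
    then obtain k r where "0 \<le> k" "0 \<le> r" "r \<le> int M" "sum ?w (?P - S) = k * int M + r"
      "?g r \<le> (\<Sum>A\<in>?P - S. ?g (?w A))" by blast
    then show ?thesis
      using sumw sum.subset_diff[OF that(1) finP, of ?w]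
        sum.subset_diff[OF that(1) finP, of "\<lambda>A. ?g (?w A)"]
      by (intro exI[of _ k] exI[of _ r]) linarith
  qed
  \<comment> \<open>Cauchy-Schwarz alone gives only 3/7; the deviation term is needed for two classes larger than M.\<close>
  have main: "0 \<le> (\<Sum>A\<in>?P. ?g (?w A)) + 3 * ?dev"
  proof (cases "\<exists>A\<in>?P. M < card A")
    case False
    then have "0 \<le> (\<Sum>A\<in>?P. ?g (?w A))"
      by (intro sum_nonneg turan_cubic_nonneg) (auto simp: not_less)
    moreover have "0 \<le> ?dev" by (intro sum_nonneg) auto
    ultimately show ?thesis by simp
  next
    case True
    then obtain A where A: "A \<in> ?P" "M < card A" by blast
    show ?thesis
    proof (cases "\<exists>B\<in>?P - {A}. M < card B")
      case False
      obtain k r where k: "0 \<le> k" "0 \<le> r" "r \<le> int M" "3 * int M - card A = k * int M + r"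
        and g: "?g r + ?g (?w A) \<le> (\<Sum>A\<in>?P. ?g (?w A))"
        using merge[of "{A}"] A False by (auto simp: not_less)
      have "0 \<le> ?g r + ?g (?w A)"
      proof (cases "2 * M \<le> card A")
        case True
        then have "0 \<le> ?g (?w A)"
          unfolding turan_cubic_def by (intro mult_nonneg_nonneg) auto
        then show ?thesis using turan_cubic_nonneg[of r "int M"] k by simp
      next
        case False
        have "k * int M < 2 * int M" "0 < k * int M" using A k False by linarith+
        then have "k < 2" "0 < k" using \<open>0 < M\<close> by (auto simp: zero_less_mult_iff)
        then have "k = 1" by simp
        then have "r = 2 * int M - ?w A" using k by simp
        \<comment> \<open>class sizes t, M, 2M - t contribute zero in total\<close>
        moreover have "?g (2 * int M - t) + ?g t = 0" for t
          by (simp add: turan_cubic_def algebra_simps)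
        ultimately show ?thesis by simp
      qed
      moreover have "0 \<le> ?dev" by (intro sum_nonneg) auto
      ultimately show ?thesis using g by simp
    next
      case True
      then obtain B where B: "B \<in> ?P" "A \<noteq> B" "M < card B" by blast
      obtain i j where ij: "i \<in> I" "A = cls i" "j \<in> I" "B = cls j" using A B by blast
      have small: "card C \<le> M" if "C \<in> ?P - {A, B}" for C
      proof -
        have "(\<Sum>A\<in>{A, B, C}. ?w A) \<le> (\<Sum>A\<in>?P. ?w A)"
          using A B that finP by (intro sum_mono2) auto
        moreover have "C \<noteq> A" "C \<noteq> B" using that by auto
        ultimately show ?thesis using sumw A B by simp
      qed
      obtain k r where k: "0 \<le> k" "0 \<le> r" "r \<le> int M"
          "3 * int M - card A - card B = k * int M + r"
        and g: "?g r + ?g (?w A) + ?g (?w B) \<le> (\<Sum>A\<in>?P. ?g (?w A))"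
        using merge[of "{A, B}"] A B small by (auto simp: algebra_simps)
      define x y where "x = card A - M" and "y = card B - M"
      have xy: "card A = M + x" "card B = M + y" "0 < x" "0 < y" using A B by (auto simp: x_def y_def)
      have "k * int M < 1 * int M" using k xy by simp
      then have "k = 0" using \<open>0 < M\<close> k(1) mult_less_cancel_right_pos[of "int M" k 1] by simp
      then have r: "r = int M - x - y" using k xy by simp
      have "?g r + ?g (?w A) + ?g (?w B) = - 3 * (int x * int y * (int x + int y))"
        unfolding xy r by (simp add: turan_cubic_def algebra_simps)
      moreover have "int ((x + y) * ((x + y) + 1) * (2 * (x + y) + 1)) \<le> 6 * ?dev"
        using sum_outdeg_deviation[of i j M "x + y"] I ij A B xy by simp
      \<comment> \<open>By the preceding bound, the deviation term is at least half of z(z + 1)(2z +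
        1) with z = x + y, and it has to cover 3xy(x + y). This follows, with room to spare, from
        4xy \<le> (x + y)^2.\<close>
      moreover have "6 * (int x * int y * (int x + int y)) \<le>
          int ((x + y) * ((x + y) + 1) * (2 * (x + y) + 1))"
      proof -
        have "int x * int y * 4 \<le> (int x + int y)\<^sup>2"
          using zero_le_power2[of "int x - int y"] by (simp add: power2_eq_square algebra_simps)
        then have "int x * int y * 4 * (int x + int y) \<le> (int x + int y)\<^sup>2 * (int x + int y)"
          by (intro mult_right_mono) auto
        also have "2 * \<dots> \<le> int ((x + y) * ((x + y) + 1) * (2 * (x + y) + 1))"
          by (simp add: power2_eq_square algebra_simps)
        moreover have "0 \<le> int x * int y * (int x + int y)" by simp
        ultimately show ?thesis by linarith
      qed
      ultimately show ?thesis using g by linarith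
    qed
  qed
  \<comment> \<open>The linear terms are 3M(2d + a), whose total is given by
    \<open>sum_outdeg\<close>. The multiplier 3M leaves quadratics with roots M, 2M in the class
    size and a double root M in the out-degree.\<close>
  have "int (\<Sum>i\<in>I. (card (cls i))\<^sup>2 + 3 * (outdeg i)\<^sup>2) =
      (\<Sum>i\<in>I. (int (card (cls i)) - M) * (int (card (cls i)) - 2 * M)) + 3 * ?dev
      + (\<Sum>i\<in>I. 3 * int M * card (cls i) + 6 * int M * outdeg i - 5 * int M * int M)"
    unfolding of_nat_sum sum_distrib_left sum.distrib[symmetric]
    by (intro sum.cong) (auto simp: power2_eq_square algebra_simps)
  also have "(\<Sum>i\<in>I. (int (card (cls i)) - M) * (int (card (cls i)) - 2 * M))
      = (\<Sum>A\<in>?P. ?g (?w A))"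
    using sum_cls[of "\<lambda>t. (int t - M) * (int t - 2 * M)"] by (simp add: turan_cubic_def mult.assoc)
  also have "(\<Sum>i\<in>I. 3 * int M * card (cls i) + 6 * int M * outdeg i - 5 * int M * int M)
      = 3 * int M * int (2 * (\<Sum>i\<in>I. outdeg i) + (\<Sum>i\<in>I. card (cls i))) - 15 * int M ^ 3"
    by (simp add: sum.distrib sum_subtractf sum_distrib_left I power3_eq_cube algebra_simps)
  also have "\<dots> = 12 * int M ^ 3"
    unfolding sum_outdeg I by (simp add: power3_eq_cube algebra_simps)
  finally have "12 * int M ^ 3 \<le> int (\<Sum>i\<in>I. (card (cls i))\<^sup>2 + 3 * (outdeg i)\<^sup>2)"
    using main by linarith
  then have "int (12 * M ^ 3) \<le> int (\<Sum>i\<in>I. (card (cls i))\<^sup>2 + 3 * (outdeg i)\<^sup>2)"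
    by (simp only: of_nat_mult of_nat_numeral of_nat_power)
  then show ?thesis by (simp only: of_nat_le_iff)
qed

end

section \<open>Induced copies of the forbidden graphs\<close>

lemma image_mem_image_iff:
  assumes "inj_on f S" "e \<subseteq> S" "\<forall>e\<in>F. e \<subseteq> S"
  shows "f ` e \<in> (`) f ` F \<longleftrightarrow> e \<in> F"
  using assms by (auto simp: inj_on_image_eq_iff)

text \<open>For 3-uniform hypergraphs an induced copy is an embedding g of H respecting triples; g
  is inverse to the map in \<open>isomorphic\<close>. Restricting to x < y < z leaves one condition
  per triple, in the form that \<open>triple_mem_forbidden\<close> evaluates.\<close>

lemma contains_induced_iff:
  fixes H :: "nat hypergraph"
  assumes G: "three_graph G" and H: "three_graph H"
  shows "contains_induced G H \<longleftrightarrow> (\<exists>g. inj_on g (verts H) \<and> g ` verts H \<subseteq> verts G \<and>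
    (\<forall>x\<in>verts H. \<forall>y\<in>verts H. \<forall>z\<in>verts H. x < y \<longrightarrow> y < z \<longrightarrow>
      ({g x, g y, g z} \<in> edges G \<longleftrightarrow> {x, y, z} \<in> edges H)))" (is "_ \<longleftrightarrow> (\<exists>g. ?emb g)")
proof
  assume "contains_induced G H"
  then obtain S f where S: "S \<subseteq> verts G" and f: "bij_betw f S (verts H)"
    and e: "edges H = (`) f ` {e \<in> edges G. e \<subseteq> S}"
    by (auto simp: contains_induced_def isomorphic_def induced_subgraph_def verts_def edges_def)
  define g where "g = inv_into S f"
  have g: "bij_betw g (verts H) S" using f by (simp add: g_def bij_betw_inv_into)
  have fg: "f (g x) = x" if "x \<in> verts H" for x
    using f that by (simp add: g_def bij_betw_inv_into_right)
  have "{g x, g y, g z} \<in> edges G \<longleftrightarrow> {x, y, z} \<in> edges H"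
    if "x \<in> verts H" "y \<in> verts H" "z \<in> verts H" for x y z
  proof -
    have "f ` {g x, g y, g z} = {x, y, z}" "{g x, g y, g z} \<subseteq> S"
      using that fg bij_betw_apply[OF g] by simp_all
    then show ?thesis
      unfolding e using image_mem_image_iff[of f S "{g x, g y, g z}" "{e \<in> edges G. e \<subseteq> S}"] f
      by (simp add: bij_betw_def)
  qed
  then have "?emb g" using g S by (auto simp: bij_betw_def)
  then show "\<exists>g. ?emb g" by (rule exI[of _ g])
next
  assume "\<exists>g. ?emb g"
  then obtain g where "?emb g" ..
  then have inj: "inj_on g (verts H)" and sub: "g ` verts H \<subseteq> verts G"
    and e: "\<And>x y z. x \<in> verts H \<Longrightarrow> y \<in> verts H \<Longrightarrow> z \<in> verts H \<Longrightarrow> x < y \<Longrightarrow> y < z \<Longrightarrow>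
      {g x, g y, g z} \<in> edges G \<longleftrightarrow> {x, y, z} \<in> edges H"
    by simp_all
  define f where "f = inv_into (verts H) g"
  have f: "bij_betw f (g ` verts H) (verts H)"
    using inj by (simp add: f_def bij_betw_inv_into inj_on_imp_bij_betw)
  have E: "g ` T \<in> edges G \<longleftrightarrow> T \<in> edges H" if "T \<subseteq> verts H" "card T = 3" for T
  proof -
    have "finite T" using that(2) card.infinite by fastforce
    define l where "l = sorted_list_of_set T"
    have "length l = 3" "sorted_wrt (<) l" "set l = T"
      using that \<open>finite T\<close> by (auto simp: l_def)
    then obtain x y z where "l = [x, y, z]" "x < y" "y < z"
      by (auto simp: numeral_3_eq_3 length_Suc_conv)
    with \<open>set l = T\<close> that show ?thesis using e[of x y z] by auto
  qed
  have fg: "f ` g ` T = T" if "T \<subseteq> verts H" for T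
    using inj that by (auto simp: f_def image_image subset_iff)
  have "edges H = (`) f ` {e \<in> edges G. e \<subseteq> g ` verts H}"
  proof (intro equalityI subsetI)
    fix T assume T: "T \<in> edges H"
    then have "T \<subseteq> verts H" "card T = 3" using H by (auto simp: three_graph_def)
    then show "T \<in> (`) f ` {e \<in> edges G. e \<subseteq> g ` verts H}"
      using E[of T] fg[of T] T by (intro image_eqI[of _ _ "g ` T"]) auto
  next
    fix T assume "T \<in> (`) f ` {e \<in> edges G. e \<subseteq> g ` verts H}"
    then obtain e where e: "e \<in> edges G" "e \<subseteq> g ` verts H" "T = f ` e" by blast
    then obtain T' where T': "T' \<subseteq> verts H" "e = g ` T'" by (metis subset_imageE)
    then have "card T' = 3"
      using e G inj card_image[OF inj_on_subset[OF inj T'(1)]] by (auto simp: three_graph_def)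
    then show "T \<in> edges H" using E[OF T'(1)] e T' fg by simp
  qed
  then show "contains_induced G H"
    using f sub by (auto simp: contains_induced_def isomorphic_def induced_subgraph_def
      verts_def edges_def)
qed

section \<open>The forbidden graphs as finite tables of triples\<close>

lemma three_graph_forbidden:
  "three_graph I34" "three_graph H1" "three_graph H2" "three_graph H3"
  by (auto simp: three_graph_def verts_def edges_def I34_def H1_def H2_def H3_def)

lemma verts_forbidden:
  "verts I34 = {1,2,3,4}" "verts H1 = {1,2,3,4,5}" "verts H2 = {1,2,3,4,5}" "verts H3 = {1,2,3,4,5}"
  by (simp_all add: verts_def I34_def H1_def H2_def H3_def)

lemma triple_mem_forbidden:
  fixes x y z :: nat
  assumes "x < y" "y < z"
  shows "{x, y, z} \<notin> edges I34"
    and "{x, y, z} \<in> edges H1 \<longleftrightarrow>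
      (x, y, z) \<in> {(1,2,3), (1,2,4), (1,3,4), (2,3,4), (1,2,5), (3,4,5)}"
    and "{x, y, z} \<in> edges H2 \<longleftrightarrow>
      (x, y, z) \<in> {(1,2,3), (1,2,4), (1,3,4), (2,3,4), (1,3,5), (1,4,5), (2,3,5), (2,4,5)}"
    and "{x, y, z} \<in> edges H3 \<longleftrightarrow>
      (x, y, z) \<in> {(1,2,3), (1,2,4), (1,3,4), (2,3,4), (1,2,5), (1,3,5), (1,4,5), (2,3,5), (2,4,5)}"
proof -
  have eq: "{x, y, z} = {a, b, c} \<longleftrightarrow> (x, y, z) = (a, b, c)" if "a < b" "b < c" for a b c :: nat
  proof
    assume "{x, y, z} = {a, b, c}"
    then have "sorted_list_of_set {x, y, z} = sorted_list_of_set {a, b, c}" by simp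
    then show "(x, y, z) = (a, b, c)" using assms that by simp
  qed simp
  show "{x, y, z} \<notin> edges I34" by (simp add: edges_def I34_def)
  show "{x, y, z} \<in> edges H1 \<longleftrightarrow>
      (x, y, z) \<in> {(1,2,3), (1,2,4), (1,3,4), (2,3,4), (1,2,5), (3,4,5)}"
    by (simp add: edges_def H1_def eq)
  show "{x, y, z} \<in> edges H2 \<longleftrightarrow>
      (x, y, z) \<in> {(1,2,3), (1,2,4), (1,3,4), (2,3,4), (1,3,5), (1,4,5), (2,3,5), (2,4,5)}"
    by (simp add: edges_def H2_def eq)
  show "{x, y, z} \<in> edges H3 \<longleftrightarrow>
      (x, y, z) \<in> {(1,2,3), (1,2,4), (1,3,4), (2,3,4), (1,2,5), (1,3,5), (1,4,5), (2,3,5), (2,4,5)}"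
    by (simp add: edges_def H3_def eq)
qed

text \<open>Each 5-vertex graph is a complete graph on 1, 2, 3, 4 plus a vertex 5, whose link is the
  matching 12, 34 for \<open>H1\<close>, the 4-cycle 13, 14, 23, 24 for \<open>H2\<close>, and that
  cycle with the chord 12 for \<open>H3\<close>. So a 4-cycle in a link forces the chord cd whether
  or not ab is present, and by symmetry it forces both.\<close>

lemma induced_freeD:
  assumes G: "three_graph G" and free: "induced_free {I34, H1, H2, H3} G"
  shows no_independent_4: "{a, b, c, d} \<subseteq> verts G \<Longrightarrow> distinct [a, b, c, d] \<Longrightarrow>
      {a,b,c} \<in> edges G \<or> {a,b,d} \<in> edges G \<or> {a,c,d} \<in> edges G \<or> {b,c,d} \<in> edges G"
    and K4_no_matching: "{a, b, c, d, e} \<subseteq> verts G \<Longrightarrow> distinct [a, b, c, d, e] \<Longrightarrow>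
      {a,b,c} \<in> edges G \<Longrightarrow> {a,b,d} \<in> edges G \<Longrightarrow> {a,c,d} \<in> edges G \<Longrightarrow> {b,c,d} \<in> edges G \<Longrightarrow>
      {a,b,e} \<in> edges G \<Longrightarrow> {c,d,e} \<in> edges G \<Longrightarrow>
      {a,c,e} \<in> edges G \<or> {a,d,e} \<in> edges G \<or> {b,c,e} \<in> edges G \<or> {b,d,e} \<in> edges G"
    and K4_cycle_chord: "{a, b, c, d, e} \<subseteq> verts G \<Longrightarrow> distinct [a, b, c, d, e] \<Longrightarrow>
      {a,b,c} \<in> edges G \<Longrightarrow> {a,b,d} \<in> edges G \<Longrightarrow> {a,c,d} \<in> edges G \<Longrightarrow> {b,c,d} \<in> edges G \<Longrightarrow>
      {a,c,e} \<in> edges G \<Longrightarrow> {a,d,e} \<in> edges G \<Longrightarrow> {b,c,e} \<in> edges G \<Longrightarrow> {b,d,e} \<in> edges G \<Longrightarrow>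
      {c,d,e} \<in> edges G"
proof -
  define emb4 where "emb4 a b c d i = (if i = 1 then a else if i = 2 then b else if i = 3 then c else d)"
    for a b c d :: 'a and i :: nat
  define emb5 where "emb5 a b c d e i = (if i = 5 then e else emb4 a b c d i)"
    for a b c d e :: 'a and i :: nat
  have nc: "\<not> contains_induced G I34" "\<not> contains_induced G H1"
    "\<not> contains_induced G H2" "\<not> contains_induced G H3"
    using free by (auto simp: induced_free_def)
  {
    assume "{a, b, c, d} \<subseteq> verts G" "distinct [a, b, c, d]"
    moreover have "inj_on (emb4 a b c d) {1,2,3,4}" if "distinct [a, b, c, d]"
      using that by (auto simp: emb4_def inj_on_def)
    ultimately show "{a,b,c} \<in> edges G \<or> {a,b,d} \<in> edges G \<or> {a,c,d} \<in> edges G \<or> {b,c,d} \<in> edges G"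
      using nc(1)[unfolded contains_induced_iff[OF G three_graph_forbidden(1)], simplified not_ex,
          rule_format, of "emb4 a b c d"]
      by (auto simp: verts_forbidden triple_mem_forbidden emb4_def)
  }
  have inj5: "inj_on (emb5 a b c d e) {1,2,3,4,5}" if "distinct [a, b, c, d, e]"
    using that by (auto simp: emb5_def emb4_def inj_on_def)
  {
    assume *: "{a, b, c, d, e} \<subseteq> verts G" "distinct [a, b, c, d, e]"
      "{a,b,c} \<in> edges G" "{a,b,d} \<in> edges G" "{a,c,d} \<in> edges G" "{b,c,d} \<in> edges G"
    note sub = *(1) inj5[OF *(2)] *(3-6)
    {
      assume "{a,b,e} \<in> edges G" "{c,d,e} \<in> edges G"
      then show "{a,c,e} \<in> edges G \<or> {a,d,e} \<in> edges G \<or> {b,c,e} \<in> edges G \<or> {b,d,e} \<in> edges G"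
        using sub nc(2)[unfolded contains_induced_iff[OF G three_graph_forbidden(2)], simplified not_ex,
            rule_format, of "emb5 a b c d e"]
        by (auto simp: verts_forbidden triple_mem_forbidden emb5_def emb4_def)
    }
    {
      assume "{a,c,e} \<in> edges G" "{a,d,e} \<in> edges G" "{b,c,e} \<in> edges G" "{b,d,e} \<in> edges G"
      then show "{c,d,e} \<in> edges G"
        using sub nc(3)[unfolded contains_induced_iff[OF G three_graph_forbidden(3)], simplified not_ex,
            rule_format, of "emb5 a b c d e"]
          nc(4)[unfolded contains_induced_iff[OF G three_graph_forbidden(4)], simplified not_ex,
            rule_format, of "emb5 a b c d e"]
        by (cases "{a,b,e} \<in> edges G")
          (auto simp: verts_forbidden triple_mem_forbidden emb5_def emb4_def)
    }
  }
qed

section \<open>The orgraph of a blow-up\<close>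

text \<open>\<open>T0\<close> holds a vertex with two members of its class; \<open>T1\<close>,
  \<open>T2\<close>, \<open>T3\<close> hold an apex with two out-neighbours, the apex in first,
  second or third position, whence the coefficient 3. \<open>D\<close> absorbs the triples with a
  repeated entry, at most 3(3M)^2 = 27 M^2.\<close>

lemma (in oriented_multipartite) card_triples_ge:
  assumes I: "card I = 3 * M" "0 < M"
    and e_cls: "\<And>i j k. i \<in> I \<Longrightarrow> j \<in> cls i \<Longrightarrow> k \<in> cls i \<Longrightarrow> distinct [i, j, k] \<Longrightarrow> e i j k"
    and e_out: "\<And>i j k. i \<in> I \<Longrightarrow> j \<in> I \<Longrightarrow> k \<in> I \<Longrightarrow> out i j \<Longrightarrow> out i k \<Longrightarrow> j \<noteq> k \<Longrightarrow>
      e i j k \<and> e j i k \<and> e j k i"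
  shows "12 * M ^ 3 \<le> card {(i, j, k) \<in> I \<times> I \<times> I. e i j k} + 27 * M\<^sup>2"
proof -
  let ?out = "\<lambda>i. {j\<in>I. out i j}"
  define T0 where "T0 = (SIGMA i:I. cls i \<times> cls i)"
  define T1 where "T1 = (SIGMA i:I. ?out i \<times> ?out i)"
  define T2 where "T2 = (\<lambda>(i, j, k). (j, i, k)) ` T1"
  define T3 where "T3 = (\<lambda>(i, j, k). (j, k, i)) ` T1"
  define D where "D = (\<lambda>(i, j). (i, i, j)) ` (I \<times> I) \<union> (\<lambda>(i, j). (i, j, i)) ` (I \<times> I)
    \<union> (\<lambda>(i, j). (i, j, j)) ` (I \<times> I)"
  let ?W = "{(i, j, k) \<in> I \<times> I \<times> I. e i j k}"
  have fin: "finite T0" "finite T1" "finite T2" "finite T3"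
    using finite_I finite_cls by (auto simp: T0_def T1_def T2_def T3_def)
  have c0: "card T0 = (\<Sum>i\<in>I. (card (cls i))\<^sup>2)" and c1: "card T1 = (\<Sum>i\<in>I. (outdeg i)\<^sup>2)"
    using finite_I finite_cls
    by (simp_all add: T0_def T1_def card_cartesian_product outdeg_def power2_eq_square)
  have c23: "card T2 = card T1" "card T3 = card T1"
    unfolding T2_def T3_def by (rule card_image, auto simp: inj_on_def)+
  have T0: "j \<in> I \<and> k \<in> I \<and> \<not> out i j \<and> \<not> out j i \<and> \<not> out i k \<and> \<not> out j k" if "(i, j, k) \<in> T0" for i j k
    using that nonadj_in_cls[of i j k] by (auto simp: T0_def cls_def)
  have "T0 \<inter> T1 = {}" "T0 \<inter> T2 = {}" "T0 \<inter> T3 = {}"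
    by (auto simp: T1_def T2_def T3_def dest: T0) (auto simp: T0_def cls_def)
  moreover have "T1 \<inter> T2 = {}" "T1 \<inter> T3 = {}" "T2 \<inter> T3 = {}"
    using asym by (auto simp: T1_def T2_def T3_def)
  ultimately have "card (T0 \<union> T1 \<union> T2 \<union> T3) = card T0 + card T1 + card T2 + card T3"
    using fin by (simp add: card_Un_disjoint Int_Un_distrib2)
  then have "(\<Sum>i\<in>I. (card (cls i))\<^sup>2 + 3 * (outdeg i)\<^sup>2) = card (T0 \<union> T1 \<union> T2 \<union> T3)"
    by (simp add: c0 c1 c23 sum.distrib flip: sum_distrib_left)
  also have "\<dots> \<le> card (?W \<union> D)"
  proof (rule card_mono)
    show "finite (?W \<union> D)"
      using finite_I by (auto simp: D_def intro: finite_subset[of _ "I \<times> I \<times> I"])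
    have D: "(i, j, k) \<in> D" if "\<not> distinct [i, j, k]" "i \<in> I" "j \<in> I" "k \<in> I" for i j k
      using that by (auto simp: D_def)
    have "T0 \<subseteq> ?W \<union> D"
    proof
      fix t assume "t \<in> T0"
      moreover obtain i j k where t: "t = (i, j, k)" by (cases t)
      ultimately have m: "i \<in> I" "j \<in> cls i" "k \<in> cls i" by (auto simp: T0_def)
      then have "j \<in> I" "k \<in> I" using cls_subset by auto
      then show "t \<in> ?W \<union> D" using e_cls[OF m] D[of i j k] m t by auto
    qed
    moreover have T1: "i \<in> I \<and> j \<in> I \<and> k \<in> I \<and> out i j \<and> out i k" if "(i, j, k) \<in> T1" for i j k
      using that by (auto simp: T1_def)
    have "(i, j, k) \<in> ?W \<union> D \<and> (j, i, k) \<in> ?W \<union> D \<and> (j, k, i) \<in> ?W \<union> D" if "(i, j, k) \<in> T1" for i j k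
    proof (cases "j = k")
      case True
      then show ?thesis using T1[OF that] D[of i j k] D[of j i k] D[of j k i] by auto
    next
      case False
      then show ?thesis using T1[OF that] e_out[of i j k] by auto
    qed
    then have "T1 \<subseteq> ?W \<union> D" "T2 \<subseteq> ?W \<union> D" "T3 \<subseteq> ?W \<union> D"
      unfolding T2_def T3_def by fast+
    ultimately show "T0 \<union> T1 \<union> T2 \<union> T3 \<subseteq> ?W \<union> D" by simp
  qed
  also have "\<dots> \<le> card ?W + card D" by (rule card_Un_le)
  also have "card D \<le> card (I \<times> I) + card (I \<times> I) + card (I \<times> I)"
    unfolding D_def using finite_I
    by (intro card_Un_le[THEN order_trans] add_mono card_image_le) auto
  also have "\<dots> = 27 * M\<^sup>2" by (simp add: card_cartesian_product I power2_eq_square)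
  finally show ?thesis using sum_squares_ge[OF I] by simp
qed

lemma clones_many_edges:
  fixes G :: "'v hypergraph" and y :: "'i \<Rightarrow> bool \<Rightarrow> 'v"
  assumes G: "three_graph G" and free: "induced_free {I34, H1, H2, H3} G"
    and I: "card I = 3 * M" "0 < M"
    and mem: "\<And>i a. i \<in> I \<Longrightarrow> y i a \<in> verts G"
    and inj: "\<And>i j a b. i \<in> I \<Longrightarrow> j \<in> I \<Longrightarrow> y i a = y j b \<Longrightarrow> i = j \<and> a = b"
    and u1: "\<And>i j k a b c. i \<in> I \<Longrightarrow> j \<in> I \<Longrightarrow> k \<in> I \<Longrightarrow> i \<noteq> j \<Longrightarrow> i \<noteq> k \<Longrightarrow> j \<noteq> k \<Longrightarrow>
      {y i a, y j b, y k c} \<in> edges G \<longleftrightarrow> {y i False, y j False, y k False} \<in> edges G"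
    and u2: "\<And>i j b. i \<in> I \<Longrightarrow> j \<in> I \<Longrightarrow> i \<noteq> j \<Longrightarrow>
      {y i False, y i True, y j b} \<in> edges G \<longleftrightarrow> {y i False, y i True, y j False} \<in> edges G"
  shows "12 * M ^ 3 \<le>
    card {(i, j, k) \<in> I \<times> I \<times> I. {y i False, y j False, y k False} \<in> edges G} + 27 * M\<^sup>2"
proof -
  define e where "e i j k \<longleftrightarrow> {y i False, y j False, y k False} \<in> edges G" for i j k
  \<comment> \<open>the Fon-der-Flaass orgraph of the blown-up vertices\<close>
  define out where "out i j \<longleftrightarrow> i \<noteq> j \<and> {y i False, y i True, y j False} \<notin> edges G" for i j
  have e: "{y i a, y j b, y k c} \<in> edges G \<longleftrightarrow> e i j k"
    if "i \<in> I" "j \<in> I" "k \<in> I" "i \<noteq> j" "i \<noteq> k" "j \<noteq> k" for i j k a b c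
    using u1[OF that] by (simp add: e_def)
  have o: "{y i False, y i True, y j b} \<in> edges G \<longleftrightarrow> \<not> out i j"
    if "i \<in> I" "j \<in> I" "i \<noteq> j" for i j b
    using u2[OF that] that by (simp add: out_def)
  have o': "{y i a, y j False, y j True} \<in> edges G \<longleftrightarrow> \<not> out j i"
    if "i \<in> I" "j \<in> I" "i \<noteq> j" for i j a
    using o[of j i a] that by (simp add: insert_commute)
  have e_sym: "e i j k \<longleftrightarrow> e j i k" "e i j k \<longleftrightarrow> e j k i" for i j k
    by (simp_all add: e_def insert_commute)
  have neq: "y i a \<noteq> y j b" if "i \<in> I" "j \<in> I" "i \<noteq> j \<or> a \<noteq> b" for i j a b
    using inj that by blast
  have "finite I" using I card.infinite by fastforce
  have asym: "\<not> out j i" if "i \<in> I" "j \<in> I" "out i j" for i j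
  proof
    assume "out j i"
    have "i \<noteq> j" using that by (simp add: out_def)
    then show False
      using no_independent_4[OF G free, of "y i False" "y i True" "y j False" "y j True"]
        that mem neq \<open>out j i\<close> o[of i j] o'[of i j] by auto
  qed
  \<comment> \<open>Among two clones of i with j and k, two triples are non-edges by the arcs and
    the other two are copies of ijk.\<close>
  have src: "e i j k" if "i \<in> I" "j \<in> I" "k \<in> I" "out i j" "out i k" "j \<noteq> k" for i j k
  proof -
    have "i \<noteq> j" "i \<noteq> k" using that by (auto simp: out_def)
    then show ?thesis
      using no_independent_4[OF G free, of "y i False" "y i True" "y j False" "y k False"]
        that mem neq o[of i j] o[of i k] e[of i j k] by auto
  qed
  \<comment> \<open>The two clones of i and of j span a complete 4-vertex graph, so the forbidden
    5-vertex graphs restrict the link of any further vertex k on it.\<close>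
  have nonadj: "e i j k \<longleftrightarrow> \<not> out i k \<and> \<not> out j k"
    if "i \<in> I" "j \<in> I" "k \<in> I" "i \<noteq> j" "i \<noteq> k" "j \<noteq> k" "\<not> out i j" "\<not> out j i" for i j k
  proof -
    let ?V = "{y i False, y i True, y j False, y j True, y k False}"
    have V: "?V \<subseteq> verts G" using mem that by simp
    have dist: "distinct [y i False, y i True, y j False, y j True, y k False]"
      "distinct [y j False, y j True, y i False, y i True, y k False]"
      using neq that by auto
    have K4: "{y i False, y i True, y j b} \<in> edges G" "{y i b, y j False, y j True} \<in> edges G" for b
      using o[of i j] o'[of i j] that by auto
    have K4': "{y j False, y j True, y i b} \<in> edges G" "{y j b, y i False, y i True} \<in> edges G" for b
      using K4 by (simp_all add: insert_commute)
    have cross: "{y i a, y j b, y k False} \<in> edges G \<longleftrightarrow> e i j k"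
      "{y j a, y i b, y k False} \<in> edges G \<longleftrightarrow> e i j k" for a b
      using e[of i j k] e[of j i k] e_sym(1)[of i j k] that by auto
    have ends: "{y i False, y i True, y k False} \<in> edges G \<longleftrightarrow> \<not> out i k"
      "{y j False, y j True, y k False} \<in> edges G \<longleftrightarrow> \<not> out j k"
      using o[of i k] o[of j k] that by auto
    show ?thesis
    proof
      \<comment> \<open>Now the cross pairs form a 4-cycle in the link of k, which forces both inner
        pairs; the second is obtained with i and j exchanged. In the converse, inner pairs without
        cross pairs would be the matching of \<open>H1\<close>.\<close>
      assume "e i j k"
      then have "{y j False, y j True, y k False} \<in> edges G"
        by (intro K4_cycle_chord[OF G free V dist(1)]) (simp_all add: K4 cross)
      moreover have "{y i False, y i True, y k False} \<in> edges G"
        using V \<open>e i j k\<close>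
        by (intro K4_cycle_chord[OF G free _ dist(2)]) (simp_all add: K4' cross)
      ultimately show "\<not> out i k \<and> \<not> out j k" using ends by simp
    next
      assume "\<not> out i k \<and> \<not> out j k"
      then show "e i j k"
        using K4_no_matching[OF G free V dist(1)] by (simp add: K4 cross ends)
    qed
  qed
  interpret oriented_multipartite I out
  proof
    show "finite I" by fact
    show "\<not> out j i" if "i \<in> I" "j \<in> I" "out i j" for i j using asym that by blast
    \<comment> \<open>An arc from i to k makes ijk a non-edge by \<open>nonadj\<close> for the pair
      i, j, but an edge by \<open>nonadj\<close> for the pair j, k.\<close>
    show "\<not> out i k" if "i \<in> I" "j \<in> I" "k \<in> I"
      "\<not> out i j" "\<not> out j i" "\<not> out j k" "\<not> out k j" for i j k
    proof (cases "i = j \<or> j = k \<or> i = k")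
      case True then show ?thesis using that by (auto simp: out_def)
    next
      case False
      then show ?thesis
        using nonadj[of i j k] nonadj[of j k i] e_sym(2)[of i j k] asym[of i k] that by auto
    qed
    \<comment> \<open>Each triple of an induced 4-cycle consists of a non-adjacent diagonal and the
      head of an arc from it, hence is a non-edge by \<open>nonadj\<close>; the four vertices would
      be independent.\<close>
    show "out i k \<or> out k i \<or> out j l \<or> out l j"
      if *: "i \<in> I" "j \<in> I" "k \<in> I" "l \<in> I" "out i j" "out j k" "out k l" "out l i" for i j k l
    proof (rule ccontr)
      assume n: "\<not> ?thesis"
      have d: "i \<noteq> j" "j \<noteq> k" "k \<noteq> l" "l \<noteq> i" using * by (auto simp: out_def)
      have "i \<noteq> k" using asym[of i j] * by auto
      have "j \<noteq> l" using asym[of j k] * by auto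
      have "\<not> e i k j" using nonadj[of i k j] n * d \<open>i \<noteq> k\<close> by auto
      moreover have "\<not> e i k l" using nonadj[of i k l] n * d \<open>i \<noteq> k\<close> by auto
      moreover have "\<not> e j l k" using nonadj[of j l k] n * d \<open>j \<noteq> l\<close> by auto
      moreover have "\<not> e j l i" using nonadj[of j l i] n * d \<open>j \<noteq> l\<close> by auto
      ultimately have "\<not> e i j k" "\<not> e i k l" "\<not> e j k l" "\<not> e i j l"
        unfolding e_def by (simp_all add: insert_commute)
      moreover have "distinct [y i False, y j False, y k False, y l False]"
        using neq * d \<open>i \<noteq> k\<close> \<open>j \<noteq> l\<close> by auto
      ultimately show False
        using no_independent_4[OF G free, of "y i False" "y j False" "y k False" "y l False"] mem *
        by (simp add: e_def)
    qed
  qed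
  have "12 * M ^ 3 \<le> card {(i, j, k) \<in> I \<times> I \<times> I. e i j k} + 27 * M\<^sup>2"
  proof (rule card_triples_ge[OF I])
    show "e i j k" if "i \<in> I" "j \<in> cls i" "k \<in> cls i" "distinct [i, j, k]" for i j k
      using nonadj[of i j k] nonadj_in_cls[of i] cls_self[of i] cls_subset that by auto
    show "e i j k \<and> e j i k \<and> e j k i"
      if "i \<in> I" "j \<in> I" "k \<in> I" "out i j" "out i k" "j \<noteq> k" for i j k
      using src[OF that] e_sym[of i j k] by simp
  qed
  then show ?thesis by (simp only: e_def)
qed

section \<open>Turan's construction\<close>

lemma card_ordered_triples:
  fixes E :: "'a set set"
  assumes "finite E" "\<And>e. e \<in> E \<Longrightarrow> card e = 3"
  shows "card {(a, b, c). {a, b, c} \<in> E} = 6 * card E"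
proof -
  have c6: "finite {(a, b, c). {a, b, c} = e} \<and> card {(a, b, c). {a, b, c} = e} = 6"
    if "e \<in> E" for e :: "'a set"
  proof -
    have "card e = 3" using that assms(2) by blast
    then obtain x y z where e: "e = {x, y, z}" and d: "x \<noteq> y" "x \<noteq> z" "y \<noteq> z"
      by (auto simp: card_3_iff)
    have "{(a, b, c). {a, b, c} = e} =
        {(x, y, z), (x, z, y), (y, x, z), (y, z, x), (z, x, y), (z, y, x)}"
    proof (intro equalityI subsetI)
      fix t assume "t \<in> {(a, b, c). {a, b, c} = e}"
      then obtain a b c where t: "t = (a, b, c)" "{a, b, c} = {x, y, z}" using e by auto
      then have "a \<in> {x, y, z}" "b \<in> {x, y, z}" "c \<in> {x, y, z}"
        "x \<in> {a, b, c}" "y \<in> {a, b, c}" "z \<in> {a, b, c}" by blast+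
      then show "t \<in> {(x, y, z), (x, z, y), (y, x, z), (y, z, x), (z, x, y), (z, y, x)}"
        using d t(1) by auto
    qed (use e in auto)
    then show ?thesis using d by simp
  qed
  have "{(a, b, c). {a, b, c} \<in> E} = (\<Union>e\<in>E. {(a, b, c). {a, b, c} = e})" by auto
  also have "card \<dots> = (\<Sum>e\<in>E. card {(a, b, c). {a, b, c} = e})"
    using c6 assms(1) by (intro card_UN_disjoint) auto
  also have "\<dots> = 6 * card E" using c6 by simp
  finally show ?thesis .
qed

text \<open>Three residues alike, or two alike and the third cyclically next to them: up to the
  direction of the cycle, the complement of Turan's 3-graph without complete 4-vertex
  subgraphs.\<close>

definition turan_pattern :: "nat \<Rightarrow> nat \<Rightarrow> nat \<Rightarrow> bool" where
  "turan_pattern r s t \<longleftrightarrow> r = s \<and> (t = r \<or> t = (r + 1) mod 3) \<or>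
     r = t \<and> s = (r + 1) mod 3 \<or> s = t \<and> r = (s + 1) mod 3"

definition turan_graph :: "nat \<Rightarrow> nat hypergraph" where
  "turan_graph n = ({1..n}, {{i, j, k} | i j k.
     {i, j, k} \<subseteq> {1..n} \<and> distinct [i, j, k] \<and> turan_pattern (i mod 3) (j mod 3) (k mod 3)})"

lemma turan_pattern_sym: "turan_pattern r s t = turan_pattern s r t" "turan_pattern r s t = turan_pattern r t s"
  by (auto simp: turan_pattern_def)

lemma mod3: "m mod 3 \<in> {0, 1, 2 :: nat}"
  by auto

lemma verts_turan_graph: "verts (turan_graph n) = {1..n}"
  by (simp add: verts_def turan_graph_def)

lemma three_graph_turan_graph: "three_graph (turan_graph n)"
  by (auto simp: three_graph_def verts_def edges_def turan_graph_def)

lemma turan_graph_edge: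
  assumes "distinct [a, b, c]" "{a, b, c} \<subseteq> {1..n}"
  shows "{a, b, c} \<in> edges (turan_graph n) \<longleftrightarrow> turan_pattern (a mod 3) (b mod 3) (c mod 3)"
proof
  assume "{a, b, c} \<in> edges (turan_graph n)"
  then obtain i j k where ijk: "{a, b, c} = {i, j, k}" "distinct [i, j, k]"
    and p: "turan_pattern (i mod 3) (j mod 3) (k mod 3)"
    by (auto simp: edges_def turan_graph_def)
  have "a \<in> {i, j, k}" "b \<in> {i, j, k}" "c \<in> {i, j, k}" using ijk(1) by blast+
  then show "turan_pattern (a mod 3) (b mod 3) (c mod 3)"
    using assms(1) p by (auto simp: turan_pattern_sym)
next
  assume "turan_pattern (a mod 3) (b mod 3) (c mod 3)"
  then show "{a, b, c} \<in> edges (turan_graph n)"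
    using assms by (auto simp: edges_def turan_graph_def)
qed

lemma contains_inducedE:
  fixes H :: "nat hypergraph"
  assumes "contains_induced G H" "three_graph G" "three_graph H"
  obtains g where "inj_on g (verts H)" "g ` verts H \<subseteq> verts G"
    "\<forall>x\<in>verts H. \<forall>y\<in>verts H. \<forall>z\<in>verts H. x < y \<longrightarrow> y < z \<longrightarrow>
      ({g x, g y, g z} \<in> edges G \<longleftrightarrow> {x, y, z} \<in> edges H)"
proof -
  from assms(1)[unfolded contains_induced_iff[OF assms(2,3)]] obtain g where
    g: "inj_on g (verts H) \<and> g ` verts H \<subseteq> verts G \<and>
      (\<forall>x\<in>verts H. \<forall>y\<in>verts H. \<forall>z\<in>verts H. x < y \<longrightarrow> y < z \<longrightarrow>
        ({g x, g y, g z} \<in> edges G \<longleftrightarrow> {x, y, z} \<in> edges H))" ..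
  show thesis
    by (rule that[OF conjunct1[OF g] conjunct1[OF conjunct2[OF g]]
        conjunct2[OF conjunct2[OF g]]])
qed

text \<open>Adjacency depends on residues alone, so it suffices to run through all residue
  assignments. The second alternative in \<open>five\<close> leaves the triple r1, r2, r5 open and
  thus covers \<open>H2\<close> and \<open>H3\<close> together.\<close>

lemma turan_graph_induced_free: "induced_free {I34, H1, H2, H3} (turan_graph n)"
proof -
  have edge: "{g x, g y, g z} \<in> edges (turan_graph n) \<longleftrightarrow>
      turan_pattern (g x mod 3) (g y mod 3) (g z mod 3)"
    if "inj_on g S" "g ` S \<subseteq> verts (turan_graph n)" "x \<in> S" "y \<in> S" "z \<in> S" "x < y" "y < z"
    for g :: "nat \<Rightarrow> nat" and S x y z
  proof -
    have "g x \<noteq> g y" "g x \<noteq> g z" "g y \<noteq> g z"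
      using inj_on_contraD[OF that(1)] that by auto
    then show ?thesis using that by (intro turan_graph_edge) (auto simp: verts_turan_graph)
  qed
  have four: "\<forall>r1\<in>{0,1,2}. \<forall>r2\<in>{0,1,2}. \<forall>r3\<in>{0,1,2}. \<forall>r4\<in>{0,1,2}.
      turan_pattern r1 r2 r3 \<or> turan_pattern r1 r2 r4 \<or> turan_pattern r1 r3 r4 \<or> turan_pattern r2 r3 r4"
    by (simp add: turan_pattern_def)
  have five: "\<forall>r1\<in>{0,1,2}. \<forall>r2\<in>{0,1,2}. \<forall>r3\<in>{0,1,2}. \<forall>r4\<in>{0,1,2}. \<forall>r5\<in>{0,1,2}.
      \<not> (turan_pattern r1 r2 r3 \<and> turan_pattern r1 r2 r4 \<and> turan_pattern r1 r3 r4 \<and>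
       turan_pattern r2 r3 r4 \<and>
       (turan_pattern r1 r2 r5 \<and> turan_pattern r3 r4 r5 \<and> \<not> turan_pattern r1 r3 r5 \<and>
          \<not> turan_pattern r1 r4 r5 \<and> \<not> turan_pattern r2 r3 r5 \<and> \<not> turan_pattern r2 r4 r5 \<or>
        \<not> turan_pattern r3 r4 r5 \<and> turan_pattern r1 r3 r5 \<and>
          turan_pattern r1 r4 r5 \<and> turan_pattern r2 r3 r5 \<and> turan_pattern r2 r4 r5))"
    by (simp add: turan_pattern_def)
  have "\<not> contains_induced (turan_graph n) I34"
  proof
    assume c: "contains_induced (turan_graph n) I34"
    obtain g where g: "inj_on g (verts I34)" "g ` verts I34 \<subseteq> verts (turan_graph n)"
      "\<forall>x\<in>verts I34. \<forall>y\<in>verts I34. \<forall>z\<in>verts I34. x < y \<longrightarrow> y < z \<longrightarrow>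
        ({g x, g y, g z} \<in> edges (turan_graph n) \<longleftrightarrow> {x, y, z} \<in> edges I34)"
      by (rule contains_inducedE[OF c three_graph_turan_graph three_graph_forbidden(1)])
    have "\<not> turan_pattern (g x mod 3) (g y mod 3) (g z mod 3)"
      if "x \<in> {1,2,3,4}" "y \<in> {1,2,3,4}" "z \<in> {1,2,3,4}" "x < y" "y < z" for x y z
      using g(3)[rule_format, of x y z] edge[OF g(1,2), of x y z] that triple_mem_forbidden(1)
      unfolding verts_forbidden by blast
    then show False
      using four[rule_format, OF mod3[of "g 1"] mod3[of "g 2"] mod3[of "g 3"] mod3[of "g 4"]] by simp
  qed
  moreover have "\<not> contains_induced (turan_graph n) H"
    if H: "three_graph H" "verts H = {1,2,3,4,5}" and K4: "{1,2,3} \<in> edges H" "{1,2,4} \<in> edges H"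
      "{1,3,4} \<in> edges H" "{2,3,4} \<in> edges H"
      and link: "{1,2,5} \<in> edges H \<and> {3,4,5} \<in> edges H \<and> {1,3,5} \<notin> edges H \<and>
          {1,4,5} \<notin> edges H \<and> {2,3,5} \<notin> edges H \<and> {2,4,5} \<notin> edges H \<or>
        {3,4,5} \<notin> edges H \<and> {1,3,5} \<in> edges H \<and>
          {1,4,5} \<in> edges H \<and> {2,3,5} \<in> edges H \<and> {2,4,5} \<in> edges H" for H :: "nat hypergraph"
  proof
    assume c: "contains_induced (turan_graph n) H"
    obtain g where g: "inj_on g (verts H)" "g ` verts H \<subseteq> verts (turan_graph n)"
      "\<forall>x\<in>verts H. \<forall>y\<in>verts H. \<forall>z\<in>verts H. x < y \<longrightarrow> y < z \<longrightarrow>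
        ({g x, g y, g z} \<in> edges (turan_graph n) \<longleftrightarrow> {x, y, z} \<in> edges H)"
      by (rule contains_inducedE[OF c three_graph_turan_graph H(1)])
    have eq: "turan_pattern (g x mod 3) (g y mod 3) (g z mod 3) \<longleftrightarrow> {x, y, z} \<in> edges H"
      if "x \<in> {1,2,3,4,5}" "y \<in> {1,2,3,4,5}" "z \<in> {1,2,3,4,5}" "x < y" "y < z" for x y z
      using g(3)[rule_format, of x y z] edge[OF g(1,2), of x y z] that unfolding H(2) by blast
    show False
      using five[rule_format, OF mod3[of "g 1"] mod3[of "g 2"] mod3[of "g 3"] mod3[of "g 4"]
          mod3[of "g 5"]] K4 link
      by (simp add: eq, argo)
  qed
  ultimately show ?thesis
    unfolding induced_free_def
    using three_graph_forbidden verts_forbidden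
    by (simp add: triple_mem_forbidden)
qed

text \<open>The 12 patterns are 3 constant ones and 3 arrangements for each of 3 cyclic pairs. The
  quotients run from 0 to n div 3, which explains the + 1.\<close>

lemma card_edges_turan_graph: "6 * card (edges (turan_graph n)) \<le> 12 * (n div 3 + 1) ^ 3"
proof -
  let ?E = "edges (turan_graph n)" and ?Q = "{..n div 3}"
  let ?P = "{(0,0,0), (1,1,1), (2,2,2), (0,0,1), (0,1,0), (1,0,0),
      (1,1,2), (1,2,1), (2,1,1), (2,2,0), (2,0,2), (0,2,2)} :: (nat \<times> nat \<times> nat) set"
  have pattern: "\<forall>r\<in>{0,1,2}. \<forall>s\<in>{0,1,2}. \<forall>t\<in>{0,1,2}. turan_pattern r s t \<longrightarrow> (r, s, t) \<in> ?P"
    by (simp add: turan_pattern_def)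
  let ?f = "\<lambda>(i, j, k). ((i mod 3, j mod 3, k mod 3), (i div 3, j div 3, k div 3 :: nat))"
  have E: "e \<subseteq> {1..n} \<and> card e = 3" if "e \<in> ?E" for e
    using three_graph_turan_graph[of n] that by (auto simp: three_graph_def verts_turan_graph)
  then have "finite ?E" by (intro finite_subset[of ?E "Pow {1..n}"]) auto
  have "6 * card ?E = card {(a, b, c). {a, b, c} \<in> ?E}"
    using card_ordered_triples[OF \<open>finite ?E\<close>] E by simp
  also have "\<dots> \<le> card (?P \<times> ?Q \<times> ?Q \<times> ?Q)"
  proof (rule card_inj_on_le)
    show "inj_on ?f {(a, b, c). {a, b, c} \<in> ?E}"
      by (rule inj_on_inverseI[where g = "\<lambda>((r, s, t), (x, y, z)). (3 * x + r, 3 * y + s, 3 * z + t)"])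
        (clarsimp simp del: insert_iff)
    show "?f ` {(a, b, c). {a, b, c} \<in> ?E} \<subseteq> ?P \<times> ?Q \<times> ?Q \<times> ?Q"
    proof (rule image_subsetI)
      fix t assume "t \<in> {(a, b, c). {a, b, c} \<in> ?E}"
      then obtain a b c where t: "t = (a, b, c)" and e: "{a, b, c} \<in> ?E" by blast
      then have "card {a, b, c} = 3" and le: "{a, b, c} \<subseteq> {1..n}" using E by blast+
      then have "distinct [a, b, c]" by (auto simp: card_insert_if split: if_splits)
      then have "turan_pattern (a mod 3) (b mod 3) (c mod 3)" using turan_graph_edge le e by blast
      then have "(a mod 3, b mod 3, c mod 3) \<in> ?P"
        by (rule pattern[rule_format, OF mod3 mod3 mod3])
      moreover have "a div 3 \<in> ?Q" "b div 3 \<in> ?Q" "c div 3 \<in> ?Q"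
        using le by (simp_all add: div_le_mono)
      ultimately show "?f t \<in> ?P \<times> ?Q \<times> ?Q \<times> ?Q"
        unfolding t prod.case by (intro SigmaI)
    qed
  qed auto
  also have "\<dots> = 12 * (n div 3 + 1) ^ 3"
    by (simp add: card_cartesian_product power3_eq_cube)
  finally show ?thesis .
qed

section \<open>Boxes in dense sets of tuples\<close>

text \<open>Two averagings. At least c/2 n^N of the g are rich, with at least cn/2 extensions, as
  the others yield at most c/2 n^(N+1) elements of P. A rich g has at least (cn/2m)^m sets of m
  extensions; there are at most n^m sets S in all, so one of them serves the stated number of
  g.\<close>

lemma dense_box_step:
  fixes c :: real
  assumes "0 < c" "finite V" "0 < m" "2 * real m \<le> c * real (card V)"
    and P: "P \<subseteq> {..<Suc N} \<rightarrow>\<^sub>E V" and cP: "c * real (card V) ^ Suc N \<le> real (card P)"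
  shows "\<exists>S\<subseteq>V. card S = m \<and> c / 2 * (c / (2 * real m)) ^ m * real (card V) ^ N
    \<le> real (card {g \<in> {..<N} \<rightarrow>\<^sub>E V. \<forall>x\<in>S. g(N := x) \<in> P})"
proof (rule ccontr)
  let ?n = "real (card V)" and ?F = "{..<N} \<rightarrow>\<^sub>E V"
  let ?c' = "c / 2 * (c / (2 * real m)) ^ m * ?n ^ N"
  let ?K = "{S. S \<subseteq> V \<and> card S = m}"
  let ?Q = "\<lambda>S. {g \<in> ?F. \<forall>x\<in>S. g(N := x) \<in> P}"
  assume neg: "\<not> ?thesis"
  define D where "D g = {x\<in>V. g(N := x) \<in> P}" for g
  define B where "B = {g \<in> ?F. c / 2 * ?n \<le> real (card (D g))}"
  have n0: "0 < ?n" using assms by (auto simp: zero_less_mult_iff intro!: gr0I)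
  have finF: "finite ?F" using \<open>finite V\<close> by (intro finite_PiE) auto
  have cF: "card ?F = card V ^ N" by (simp add: card_funcsetE)
  have finD: "finite (D g)" for g using \<open>finite V\<close> by (simp add: D_def)
  have finK: "finite ?K" using \<open>finite V\<close> by simp
  have Peq: "P = (\<lambda>(g, x). g(N := x)) ` (SIGMA g:?F. D g)"
  proof (intro equalityI subsetI)
    fix f assume "f \<in> P"
    then have "f \<in> {..<Suc N} \<rightarrow>\<^sub>E V" using P by blast
    then have "restrict f {..<N} \<in> ?F" "f N \<in> V" "(restrict f {..<N})(N := f N) = f"
      by (auto simp: PiE_def extensional_def fun_eq_iff)
    then show "f \<in> (\<lambda>(g, x). g(N := x)) ` (SIGMA g:?F. D g)"
      using \<open>f \<in> P\<close> by (intro image_eqI[of _ _ "(restrict f {..<N}, f N)"]) (auto simp: D_def)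
  qed (auto simp: D_def)
  have inj: "inj_on (\<lambda>(g, x). g(N := x)) (SIGMA g:?F. D g)"
  proof (rule inj_onI, clarify)
    fix g x g' x' assume "g \<in> ?F" "g' \<in> ?F" and eq: "g(N := x) = g'(N := x')"
    then have "g N = g' N" by (auto simp: PiE_def extensional_def)
    have "g = g'"
    proof
      show "g i = g' i" for i
        using \<open>g N = g' N\<close> fun_cong[OF eq, of i] by (cases "i = N") simp_all
    qed
    then show "g = g' \<and> x = x'" using fun_cong[OF eq, of N] by simp
  qed
  have "card P = (\<Sum>g\<in>?F. card (D g))"
    unfolding Peq by (subst card_image[OF inj]) (use finF finD in \<open>simp add: card_SigmaI\<close>)
  then have "c * ?n ^ Suc N \<le> (\<Sum>g\<in>?F. real (card (D g)))" using cP by simp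
  also have "\<dots> \<le> (\<Sum>g\<in>?F. (if g \<in> B then ?n else 0) + c / 2 * ?n)"
  proof (intro sum_mono)
    fix g assume "g \<in> ?F"
    have "card (D g) \<le> card V" using \<open>finite V\<close> by (intro card_mono) (auto simp: D_def)
    moreover have "g \<in> B \<or> real (card (D g)) < c / 2 * ?n"
      using \<open>g \<in> ?F\<close> unfolding B_def mem_Collect_eq by linarith
    moreover have "0 \<le> c / 2 * ?n" using \<open>0 < c\<close> by simp
    ultimately show "real (card (D g)) \<le> (if g \<in> B then ?n else 0) + c / 2 * ?n" by auto
  qed
  also have "\<dots> = ?n * card B + ?n ^ N * (c / 2 * ?n)"
  proof -
    have "?F \<inter> {g. g \<in> B} = B" by (auto simp: B_def)
    then show ?thesis using finF by (simp add: sum.distrib sum.If_cases cF)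
  qed
  finally have "?n * (c / 2 * ?n ^ N) \<le> ?n * card B" by (simp add: field_simps)
  then have cB: "c / 2 * ?n ^ N \<le> card B" using n0 by (simp only: mult_le_cancel_left_pos)
  have cK: "real (card ?K) \<le> ?n ^ m"
  proof -
    have "m \<le> card V \<or> card V < m" by linarith
    then have "card V choose m \<le> card V ^ m" by (auto intro: binomial_le_pow simp: binomial_eq_0)
    then show ?thesis using \<open>finite V\<close> by (simp add: n_subsets flip: of_nat_power)
  qed
  have "c / 2 * ?n ^ N * (c / (2 * real m) * ?n) ^ m \<le> card B * (c / (2 * real m) * ?n) ^ m"
    using cB assms by (intro mult_right_mono) auto
  also have "\<dots> = (\<Sum>g\<in>B. (c / (2 * real m) * ?n) ^ m)" by simp
  also have "\<dots> \<le> (\<Sum>g\<in>B. real (card {S. S \<subseteq> D g \<and> card S = m}))"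
  proof (intro sum_mono)
    fix g assume "g \<in> B"
    then have Dg: "c / 2 * ?n \<le> real (card (D g))" by (simp add: B_def)
    then have "m \<le> card (D g)" using assms by simp
    have "(c / (2 * real m) * ?n) ^ m \<le> (real (card (D g)) / real m) ^ m"
    proof (rule power_mono)
      show "c / (2 * real m) * ?n \<le> real (card (D g)) / real m"
        using divide_right_mono[OF Dg, of "real m"] by simp
      show "0 \<le> c / (2 * real m) * ?n" using \<open>0 < c\<close> by simp
    qed
    also have "\<dots> \<le> real (card (D g) choose m)"
      using \<open>m \<le> card (D g)\<close> by (rule binomial_ge_n_over_k_pow_k)
    finally show "(c / (2 * real m) * ?n) ^ m \<le> real (card {S. S \<subseteq> D g \<and> card S = m})"
      unfolding n_subsets[OF finD] .
  qed
  also have "\<dots> \<le> (\<Sum>g\<in>B. real (card {S\<in>?K. g \<in> ?Q S}))"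
  proof (rule sum_mono)
    fix g assume "g \<in> B"
    then have "{S. S \<subseteq> D g \<and> card S = m} \<subseteq> {S\<in>?K. g \<in> ?Q S}" by (auto simp: D_def B_def)
    then show "real (card {S. S \<subseteq> D g \<and> card S = m}) \<le> real (card {S\<in>?K. g \<in> ?Q S})"
      by (intro of_nat_mono card_mono finite_subset[OF _ finK]) auto
  qed
  also have "\<dots> \<le> (\<Sum>g\<in>?F. real (card {S\<in>?K. g \<in> ?Q S}))"
    using finF by (intro sum_mono2) (auto simp: B_def)
  also have "\<dots> = real (\<Sum>g\<in>?F. card {S\<in>?K. g \<in> ?Q S})" by simp
  also have "(\<Sum>g\<in>?F. card {S\<in>?K. g \<in> ?Q S}) = (\<Sum>S\<in>?K. card {g\<in>?F. g \<in> ?Q S})"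
    by (rule sum_multicount_gen) (use finF finK in auto)
  also have "real \<dots> = (\<Sum>S\<in>?K. real (card (?Q S)))" by (simp cong: conj_cong)
  finally have le: "c / 2 * ?n ^ N * (c / (2 * real m) * ?n) ^ m \<le> (\<Sum>S\<in>?K. real (card (?Q S)))" .
  have pos: "0 < c / 2 * ?n ^ N * (c / (2 * real m) * ?n) ^ m" using assms n0 by simp
  have "?K \<noteq> {}"
  proof
    assume "?K = {}"
    show False using less_le_trans[OF pos le] unfolding \<open>?K = {}\<close> by simp
  qed
  then have "(\<Sum>S\<in>?K. real (card (?Q S))) < (\<Sum>S\<in>?K. ?c')"
    using neg finK by (intro sum_strict_mono) (auto simp: not_le)
  also have "\<dots> = card ?K * ?c'" by simp
  also have "\<dots> \<le> ?n ^ m * ?c'" using cK assms by (intro mult_right_mono) auto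
  also have "\<dots> = c / 2 * ?n ^ N * (c / (2 * real m) * ?n) ^ m"
    unfolding power_mult_distrib[of "c / (2 * real m)" ?n] by (simp only: mult_ac)
  finally show False using le by (meson leD)
qed

text \<open>Induction on N, splitting off the last coordinate; c is arbitrary because each step
  lowers the density to \<open>c'\<close>. The sides \<open>X i\<close> may overlap here.\<close>

proposition dense_contains_box:
  fixes c :: real
  assumes "0 < c" "0 < m"
  shows "\<exists>n0. \<forall>V P. finite V \<and> n0 \<le> card (V :: 'a set) \<and> P \<subseteq> {..<N} \<rightarrow>\<^sub>E V \<and>
      c * real (card V) ^ N \<le> real (card P) \<longrightarrow>
      (\<exists>X. (\<forall>i<N. X i \<subseteq> V \<and> card (X i) = m) \<and> Pi\<^sub>E {..<N} X \<subseteq> P)"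
  using \<open>0 < c\<close>
proof (induction N arbitrary: c)
  case 0
  have "Pi\<^sub>E {..<0::nat} X \<subseteq> P"
    if "P \<subseteq> {..<0::nat} \<rightarrow>\<^sub>E V" "c * real (card V) ^ 0 \<le> real (card P)"
    for V :: "'a set" and P and X :: "nat \<Rightarrow> 'a set"
  proof -
    have "P \<noteq> {}" using that 0 by auto
    then show ?thesis using that by auto
  qed
  then show ?case by (intro exI[of _ 0] allI impI exI[of _ "\<lambda>_. {}"]) simp
next
  case (Suc N)
  define c' where "c' = c / 2 * (c / (2 * real m)) ^ m"
  have "0 < c'" using Suc.prems \<open>0 < m\<close> by (simp add: c'_def)
  from Suc.IH[OF this] obtain n0 where n0: "\<forall>V P. finite V \<and> n0 \<le> card (V :: 'a set) \<and>
      P \<subseteq> {..<N} \<rightarrow>\<^sub>E V \<and> c' * real (card V) ^ N \<le> real (card P) \<longrightarrow>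
      (\<exists>X. (\<forall>i<N. X i \<subseteq> V \<and> card (X i) = m) \<and> Pi\<^sub>E {..<N} X \<subseteq> P)" ..
  show ?case
  proof (rule exI[of _ "max n0 (nat \<lceil>2 * real m / c\<rceil>)"], intro allI impI, elim conjE)
    fix V :: "'a set" and P
    assume fin: "finite V" and n: "max n0 (nat \<lceil>2 * real m / c\<rceil>) \<le> card V"
      and P: "P \<subseteq> {..<Suc N} \<rightarrow>\<^sub>E V" "c * real (card V) ^ Suc N \<le> real (card P)"
    have "2 * real m / c \<le> real (card V)" using n by linarith
    then have "2 * real m \<le> c * real (card V)" using Suc.prems by (simp add: field_simps)
    from dense_box_step[OF Suc.prems fin \<open>0 < m\<close> this P] obtain S where
      S: "S \<subseteq> V" "card S = m"
      and Q: "c' * real (card V) ^ N \<le> real (card {g \<in> {..<N} \<rightarrow>\<^sub>E V. \<forall>x\<in>S. g(N := x) \<in> P})"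
      unfolding c'_def by blast
    obtain X where X: "\<And>i. i < N \<Longrightarrow> X i \<subseteq> V \<and> card (X i) = m"
      and box: "Pi\<^sub>E {..<N} X \<subseteq> {g \<in> {..<N} \<rightarrow>\<^sub>E V. \<forall>x\<in>S. g(N := x) \<in> P}"
      using n0[rule_format, of V, OF conjI[OF fin conjI[OF _ conjI[OF _ Q]]]] n by auto
    have "f \<in> P" if f: "f \<in> Pi\<^sub>E {..<Suc N} (X(N := S))" for f
    proof -
      have "restrict f {..<N} \<in> Pi\<^sub>E {..<N} X" "f N \<in> S"
        using f by (auto simp: PiE_iff split: if_splits)
      then have "(restrict f {..<N})(N := f N) \<in> P" using box by blast
      also have "(restrict f {..<N})(N := f N) = f"
        using f by (auto simp: fun_eq_iff PiE_def extensional_def)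
      finally show ?thesis .
    qed
    then show "\<exists>X. (\<forall>i<Suc N. X i \<subseteq> V \<and> card (X i) = m) \<and> Pi\<^sub>E {..<Suc N} X \<subseteq> P"
      using X S by (intro exI[of _ "X(N := S)"]) (auto simp: less_Suc_eq)
  qed
qed

section \<open>Homogeneous clones\<close>

text \<open>
  Number the elements of each X i and colour triples of numbers a < b < c by the set of all
  (i, j, k) whose elements numbered a, b, c form an edge. Giving each index i its own
  block of two consecutive elements of a homogeneous set makes the pattern independent of the choice.
\<close>

lemma uniform_clones:
  fixes N :: nat
  shows "\<exists>m>0. \<forall>(E :: 'v set set) X. (\<forall>i<N. card (X i) = m) \<longrightarrow>
     (\<exists>y. (\<forall>i<N. \<forall>a. y i a \<in> X i) \<and> (\<forall>i<N. y i False \<noteq> y i True) \<and>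
       (\<forall>i<N. \<forall>j<N. \<forall>k<N. \<forall>a b c. i \<noteq> j \<longrightarrow> i \<noteq> k \<longrightarrow> j \<noteq> k \<longrightarrow>
         ({y i a, y j b, y k c} \<in> E \<longleftrightarrow> {y i False, y j False, y k False} \<in> E)) \<and>
       (\<forall>i<N. \<forall>j<N. \<forall>b. i \<noteq> j \<longrightarrow>
         ({y i False, y i True, y j b} \<in> E \<longleftrightarrow> {y i False, y i True, y j False} \<in> E)))"
proof -
  let ?N3 = "{..<N} \<times> {..<N} \<times> {..<N}"
  have "finite (Pow ?N3)" by simp
  then obtain h q where h: "bij_betw h (Pow ?N3) {0..<q::nat}"
    using ex_bij_betw_finite_nat by blast
  obtain m0 :: nat where "partn_lst {..<m0} (replicate q (2 * N)) 3"
    using ramsey_full[of "replicate q (2 * N)" 3] by auto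
  \<comment> \<open>The extra element makes the common size of the \<open>X i\<close>
    positive.\<close>
  then have R: "partn_lst {..<Suc m0} (replicate q (2 * N)) 3"
    by (rule partn_lst_greater_resource) simp
  show ?thesis
  proof (intro exI[of _ "Suc m0"] conjI allI impI)
    fix E :: "'v set set" and X :: "nat \<Rightarrow> 'v set" assume X: "\<forall>i<N. card (X i) = Suc m0"
    have "\<exists>x. bij_betw x {..<Suc m0} (X i)" if "i < N" for i
    proof -
      have "card (X i) = Suc m0" using X that by blast
      moreover from this have "finite (X i)" by (metis card.infinite nat.distinct(1))
      ultimately show ?thesis using ex_bij_betw_nat_finite[of "X i"] by (simp add: atLeast0LessThan)
    qed
    then obtain x where x: "\<And>i. i < N \<Longrightarrow> bij_betw (x i) {..<Suc m0} (X i)" by metis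
    \<comment> \<open>Indices may repeat: the entries (i, i, j) and (i, j, j) record triples with
      two clones of one index.\<close>
    define col where "col S = (let l = sorted_list_of_set S in
      {(i, j, k) \<in> ?N3. {x i (l ! 0), x j (l ! 1), x k (l ! 2)} \<in> E})" for S
    have col_mem: "col S \<in> Pow ?N3" for S by (auto simp: col_def Let_def)
    have "(\<lambda>S. h (col S)) \<in> nsets {..<Suc m0} 3 \<rightarrow> {..<q}"
      using bij_betw_apply[OF h col_mem] by (auto simp: atLeast0LessThan)
    from partn_lstE[OF R this] obtain t H where t: "t < q"
      and H: "H \<in> nsets {..<Suc m0} (2 * N)" and mono: "(\<lambda>S. h (col S)) ` nsets H 3 \<subseteq> {t}"
      by (metis length_replicate nth_replicate)
    have finH: "finite H" and cH: "card H = 2 * N" and subH: "H \<subseteq> {..<Suc m0}"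
      using H by (auto simp: nsets_def)
    define C where "C = inv_into (Pow ?N3) h t"
    have C: "col S = C" if "S \<subseteq> H" "card S = 3" for S
    proof -
      have "h (col S) = t" using that finH mono by (auto simp: nsets_def dest: finite_subset)
      then show ?thesis using h col_mem
        by (metis C_def bij_betw_inv_into_left)
    qed
    define p where "p s = sorted_list_of_set H ! s" for s
    have p_less: "p s < p s'" if "s < s'" "s' < 2 * N" for s s'
      using that cH strict_sorted_list_of_set[of H] by (simp add: p_def sorted_wrt_nth_less)
    have p_mem: "p s \<in> H" if "s < 2 * N" for s
      using that cH finH by (metis length_sorted_list_of_set nth_mem p_def set_sorted_list_of_set)
    have key: "{x i (p s), x j (p s'), x k (p s'')} \<in> E \<longleftrightarrow> (i, j, k) \<in> C"
      if "i < N" "j < N" "k < N" "s < s'" "s' < s''" "s'' < 2 * N" for i j k s s' s''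
    proof -
      have less: "p s < p s'" "p s' < p s''" "p s < p s''" using p_less that by auto
      then have "sorted_list_of_set {p s, p s', p s''} = [p s, p s', p s'']" by simp
      moreover have "col {p s, p s', p s''} = C"
        using less p_mem that by (intro C) auto
      ultimately show ?thesis using that by (auto simp: col_def)
    qed
    define y where "y i a = x i (p (2 * i + of_bool a))" for i a
    have lt: "2 * i + of_bool a < 2 * N" if "i < N" for i a
      using that by (cases a) auto
    have y_mem: "y i a \<in> X i" if "i < N" for i a
      using p_mem[OF lt[OF that]] subH x[OF that] bij_betw_apply by (fastforce simp: y_def)
    have y_neq: "y i False \<noteq> y i True" if "i < N" for i
    proof
      assume "y i False = y i True"
      then have "p (2 * i + of_bool False) = p (2 * i + of_bool True)"
        using x[OF that] subsetD[OF subH p_mem[OF lt[OF that, of False]]]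
          subsetD[OF subH p_mem[OF lt[OF that, of True]]]
        by (intro inj_onD[of "x i" "{..<Suc m0}"]) (auto simp: y_def bij_betw_def)
      then show False using p_less[of "2 * i" "2 * i + 1"] that by simp
    qed
    have sorted: "{y i a, y j b, y k c} \<in> E \<longleftrightarrow> (i, j, k) \<in> C"
      if "i < j" "j < k" "k < N" for i j k a b c
      unfolding y_def using that by (intro key) (auto simp: of_bool_def)
    have pair1: "{y i False, y i True, y j b} \<in> E \<longleftrightarrow> (i, i, j) \<in> C"
      if "i < j" "j < N" for i j b
      unfolding y_def using that by (intro key) (auto simp: of_bool_def)
    \<comment> \<open>A clone of i precedes both clones of j, so both sides amount to (i, j, j)
      \<in> C.\<close>
    have pair2: "{y i False, y j False, y j True} \<in> E \<longleftrightarrow> {y i True, y j False, y j True} \<in> E"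
      if "i < j" "j < N" for i j
      unfolding y_def using that by (subst (1 2) key) (auto simp: of_bool_def)
    show "\<exists>y. (\<forall>i<N. \<forall>a. y i a \<in> X i) \<and> (\<forall>i<N. y i False \<noteq> y i True) \<and>
       (\<forall>i<N. \<forall>j<N. \<forall>k<N. \<forall>a b c. i \<noteq> j \<longrightarrow> i \<noteq> k \<longrightarrow> j \<noteq> k \<longrightarrow>
         ({y i a, y j b, y k c} \<in> E \<longleftrightarrow> {y i False, y j False, y k False} \<in> E)) \<and>
       (\<forall>i<N. \<forall>j<N. \<forall>b. i \<noteq> j \<longrightarrow>
         ({y i False, y i True, y j b} \<in> E \<longleftrightarrow> {y i False, y i True, y j False} \<in> E))"
    proof (intro exI[of _ y] conjI allI impI y_mem y_neq)
      fix i j k a b c assume "i < N" "j < N" "k < N" "i \<noteq> j" "i \<noteq> k" "j \<noteq> k"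
      then consider "i < j" "j < k" | "i < k" "k < j" | "j < i" "i < k" | "j < k" "k < i"
        | "k < i" "i < j" | "k < j" "j < i" by linarith
      then show "{y i a, y j b, y k c} \<in> E \<longleftrightarrow> {y i False, y j False, y k False} \<in> E"
      proof cases
        case 1 then show ?thesis using sorted[of i j k] \<open>k < N\<close> by simp
      next
        case 2 then show ?thesis
          using sorted[of i k j a c b] sorted[of i k j False False False] \<open>j < N\<close> by (simp add: insert_commute)
      next
        case 3 then show ?thesis
          using sorted[of j i k b a c] sorted[of j i k False False False] \<open>k < N\<close> by (simp add: insert_commute)
      next
        case 4 then show ?thesis
          using sorted[of j k i b c a] sorted[of j k i False False False] \<open>i < N\<close> by (simp add: insert_commute)
      next
        case 5 then show ?thesis
          using sorted[of k i j c a b] sorted[of k i j False False False] \<open>j < N\<close> by (simp add: insert_commute)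
      next
        case 6 then show ?thesis
          using sorted[of k j i c b a] sorted[of k j i False False False] \<open>i < N\<close> by (simp add: insert_commute)
      qed
    next
      fix i j b assume ij: "i < N" "j < N" "i \<noteq> j"
      show "{y i False, y i True, y j b} \<in> E \<longleftrightarrow> {y i False, y i True, y j False} \<in> E"
      proof (cases "i < j")
        case True then show ?thesis using pair1[of i j] ij by simp
      next
        case False
        then show ?thesis using pair2[of j i] ij by (cases b) (simp_all add: insert_commute)
      qed
    qed
  qed simp
qed

section \<open>Sampling\<close>

text \<open>Counts functions by a datum \<phi> f fixing their values on J, with free values
  elsewhere. It is applied with J a triple sent to an ordered edge, and with J one of two points
  having equal images.\<close>

lemma card_functions_determined:
  assumes "finite I" "finite V" "finite A" "J \<subseteq> I"
    and "\<And>f. f \<in> S \<Longrightarrow> f \<in> I \<rightarrow>\<^sub>E V \<and> \<phi> f \<in> A"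
    and "\<And>f g i. f \<in> S \<Longrightarrow> g \<in> S \<Longrightarrow> \<phi> f = \<phi> g \<Longrightarrow>
      (\<And>i. i \<in> I - J \<Longrightarrow> f i = g i) \<Longrightarrow> i \<in> J \<Longrightarrow> f i = g i"
  shows "card S \<le> card A * card V ^ (card I - card J)"
proof -
  have "card S \<le> card (A \<times> ((I - J) \<rightarrow>\<^sub>E V))"
  proof (rule card_inj_on_le)
    show "inj_on (\<lambda>f. (\<phi> f, restrict f (I - J))) S"
    proof (rule inj_onI, clarify)
      fix f g assume fg: "f \<in> S" "g \<in> S" "\<phi> f = \<phi> g" "restrict f (I - J) = restrict g (I - J)"
      have eq: "f i = g i" if "i \<in> I - J" for i
        using fun_cong[OF fg(4), of i] that by simp
      have "f \<in> I \<rightarrow>\<^sub>E V" "g \<in> I \<rightarrow>\<^sub>E V" using assms(5) fg by blast+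
      then show "f = g"
      proof (rule PiE_ext)
        show "f i = g i" if "i \<in> I" for i
          using assms(6)[OF fg(1-3) eq] eq that by blast
      qed
    qed
    show "(\<lambda>f. (\<phi> f, restrict f (I - J))) ` S \<subseteq> A \<times> ((I - J) \<rightarrow>\<^sub>E V)"
    proof clarify
      fix f assume "f \<in> S"
      then have "f \<in> I \<rightarrow>\<^sub>E V" "\<phi> f \<in> A" using assms(5) by auto
      then show "\<phi> f \<in> A \<and> restrict f (I - J) \<in> (I - J) \<rightarrow>\<^sub>E V" by auto
    qed
    show "finite (A \<times> ((I - J) \<rightarrow>\<^sub>E V))" using assms by (intro finite_cartesian_product finite_PiE) auto
  qed
  also have "\<dots> = card A * card V ^ card (I - J)"
    using assms by (simp add: card_cartesian_product card_funcsetE)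
  also have "card (I - J) = card I - card J"
    using assms by (simp add: card_Diff_subset finite_subset)
  finally show ?thesis .
qed

lemma sum_sampled_edges:
  fixes E :: "'v set set" and I :: "'i set"
  assumes "finite I" "finite V" "finite E" "\<And>e. e \<in> E \<Longrightarrow> card e = 3" "3 \<le> card I"
  shows "(\<Sum>f\<in>I \<rightarrow>\<^sub>E V. card {(i, j, k) \<in> I \<times> I \<times> I. {f i, f j, f k} \<in> E})
    \<le> card I ^ 3 * (6 * card E * card V ^ (card I - 3))"
proof -
  let ?F = "I \<rightarrow>\<^sub>E V" and ?I3 = "I \<times> I \<times> I"
  let ?R = "\<lambda>f (i, j, k). {f i, f j, f k} \<in> E"
  have finF: "finite ?F" using assms by (intro finite_PiE) auto
  have "(\<Sum>f\<in>?F. card {t\<in>?I3. ?R f t}) = (\<Sum>t\<in>?I3. card {f\<in>?F. ?R f t})"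
    by (rule sum_multicount_gen) (use finF assms in auto)
  also have "\<dots> \<le> (\<Sum>t\<in>?I3. 6 * card E * card V ^ (card I - 3))"
  proof (rule sum_mono)
    fix t assume "t \<in> ?I3"
    then obtain i j k where t: "t = (i, j, k)" and ijk: "i \<in> I" "j \<in> I" "k \<in> I" by auto
    show "card {f\<in>?F. ?R f t} \<le> 6 * card E * card V ^ (card I - 3)"
    proof (cases "distinct [i, j, k]")
      case True
      have "finite {(a, b, c). {a, b, c} \<in> E}"
      proof (rule finite_subset)
        have "finite e" if "e \<in> E" for e using assms(4)[OF that] card.infinite by fastforce
        then show "finite (\<Union>E \<times> \<Union>E \<times> \<Union>E)" using assms(3) by auto
      qed auto
      then have "card {f\<in>?F. ?R f t} \<le>
          card {(a, b, c). {a, b, c} \<in> E} * card V ^ (card I - card {i, j, k})"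
        using assms ijk
        by (intro card_functions_determined[where \<phi> = "\<lambda>f. (f i, f j, f k)"]) (auto simp: t)
      moreover have "card {i, j, k} = 3" using True by simp
      ultimately show ?thesis by (simp only: card_ordered_triples[OF assms(3,4)])
    next
      case False
      then have "card {f i, f j, f k} \<noteq> 3" for f :: "'i \<Rightarrow> 'v"
        by (auto simp: card_insert_if split: if_splits)
      then have "{f\<in>?F. ?R f t} = {}" using assms(4) by (auto simp: t)
      then show ?thesis by (simp only: card.empty)
    qed
  qed
  also have "\<dots> = card I ^ 3 * (6 * card E * card V ^ (card I - 3))"
    by (simp add: card_cartesian_product power3_eq_cube)
  finally show ?thesis by (simp add: case_prod_unfold mem_Times_iff conj_assoc)
qed

lemma card_non_injective:
  assumes "finite I" "finite V"
  shows "card {f \<in> I \<rightarrow>\<^sub>E V. \<not> inj_on f I} \<le> card I ^ 2 * card V ^ (card I - 1)"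
proof -
  let ?N = "\<lambda>(i, j). {f \<in> I \<rightarrow>\<^sub>E V. i \<noteq> j \<and> f i = f j}"
  have "{f \<in> I \<rightarrow>\<^sub>E V. \<not> inj_on f I} \<subseteq> (\<Union>p\<in>I \<times> I. ?N p)" by (auto simp: inj_on_def)
  moreover have "finite (\<Union>p\<in>I \<times> I. ?N p)"
    by (rule finite_subset[of _ "I \<rightarrow>\<^sub>E V"]) (use assms in \<open>auto intro: finite_PiE\<close>)
  ultimately have "card {f \<in> I \<rightarrow>\<^sub>E V. \<not> inj_on f I} \<le> card (\<Union>p\<in>I \<times> I. ?N p)"
    by (rule card_mono[rotated])
  also have "\<dots> \<le> (\<Sum>p\<in>I \<times> I. card (?N p))" using assms by (intro card_UN_le) auto
  also have "\<dots> \<le> (\<Sum>p\<in>I \<times> I. card V ^ (card I - 1))"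
  proof (rule sum_mono)
    fix p assume "p \<in> I \<times> I"
    then obtain i j where p: "p = (i, j)" and ij: "i \<in> I" "j \<in> I" by auto
    have "card (?N p) \<le> card {()} * card V ^ (card I - card {i})"
      using assms ij by (intro card_functions_determined[where \<phi> = "\<lambda>_. ()"]) (auto simp: p)
    then show "card (?N p) \<le> card V ^ (card I - 1)" by simp
  qed
  also have "\<dots> = card I ^ 2 * card V ^ (card I - 1)"
    by (simp add: card_cartesian_product power2_eq_square)
  finally show ?thesis .
qed

proposition eventually_many_edges:
  fixes \<epsilon> :: real
  assumes "0 < \<epsilon>" "\<epsilon> < 4 / 9"
  shows "\<exists>n0. \<forall>G :: 'v hypergraph. three_graph G \<and> induced_free {I34, H1, H2, H3} G \<and>
    n0 \<le> card (verts G) \<longrightarrow> (4 / 9 - \<epsilon>) * real (card (verts G)) ^ 3 \<le> 6 * real (card (edges G))"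
proof -
  \<comment> \<open>Large enough that the error 27 M^2 is less than the slack \<epsilon>/2 (3M)^3 =
    27/2 \<epsilon> M^3.\<close>
  define M where "M = nat \<lceil>2 / \<epsilon>\<rceil> + 1"
  define N where "N = 3 * M"
  have "0 < M" "3 \<le> N" by (auto simp: M_def N_def)
  have "2 / \<epsilon> < real M" unfolding M_def by linarith
  then have M_large: "2 < \<epsilon> * real M" using assms by (simp add: field_simps)
  define q where "q = 4 / 9 - \<epsilon> / 2"
  have "0 < q" "q < 1" using assms by (auto simp: q_def)
  obtain m where "0 < m" and clones: "\<And>(E :: 'v set set) X. (\<forall>i<N. card (X i) = m) \<Longrightarrow>
     (\<exists>y. (\<forall>i<N. \<forall>a. y i a \<in> X i) \<and> (\<forall>i<N. y i False \<noteq> y i True) \<and>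
       (\<forall>i<N. \<forall>j<N. \<forall>k<N. \<forall>a b c. i \<noteq> j \<longrightarrow> i \<noteq> k \<longrightarrow> j \<noteq> k \<longrightarrow>
         ({y i a, y j b, y k c} \<in> E \<longleftrightarrow> {y i False, y j False, y k False} \<in> E)) \<and>
       (\<forall>i<N. \<forall>j<N. \<forall>b. i \<noteq> j \<longrightarrow>
         ({y i False, y i True, y j b} \<in> E \<longleftrightarrow> {y i False, y i True, y j False} \<in> E)))"
    using uniform_clones[where 'v = 'v, of N] by (elim exE conjE) blast
  have "0 < \<epsilon> / 4" using assms by simp
  from dense_contains_box[OF this \<open>0 < m\<close>, where 'a = 'v, of N] obtain n1 where
    n1: "\<forall>V P. finite V \<and> n1 \<le> card (V :: 'v set) \<and> P \<subseteq> {..<N} \<rightarrow>\<^sub>E V \<and>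
      \<epsilon> / 4 * real (card V) ^ N \<le> real (card P) \<longrightarrow>
      (\<exists>X. (\<forall>i<N. X i \<subseteq> V \<and> card (X i) = m) \<and> Pi\<^sub>E {..<N} X \<subseteq> P)" ..
  show ?thesis
  proof (intro exI[of _ "max n1 (nat \<lceil>4 * real N ^ 2 / \<epsilon>\<rceil> + 1)"] allI impI, elim conjE, rule ccontr)
    fix G :: "'v hypergraph"
    assume G: "three_graph G" and free: "induced_free {I34, H1, H2, H3} G"
      and n: "max n1 (nat \<lceil>4 * real N ^ 2 / \<epsilon>\<rceil> + 1) \<le> card (verts G)"
      and few: "\<not> (4 / 9 - \<epsilon>) * real (card (verts G)) ^ 3 \<le> 6 * real (card (edges G))"
    define V where "V = verts G"
    let ?n = "real (card V)" and ?F = "{..<N} \<rightarrow>\<^sub>E V"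
    define W where "W f = card {(i, j, k) \<in> {..<N} \<times> {..<N} \<times> {..<N}. {f i, f j, f k} \<in> edges G}"
      for f :: "nat \<Rightarrow> 'v"
    define L where "L = {f \<in> ?F. real (W f) < q * real N ^ 3}"
    \<comment> \<open>Injectivity makes clones of different indices distinct, since every choice
      from the box lies in \<open>P\<close>.\<close>
    define P where "P = {f \<in> L. inj_on f {..<N}}"
    have finV: "finite V" and E3: "\<And>e. e \<in> edges G \<Longrightarrow> e \<subseteq> V \<and> card e = 3"
      using G by (auto simp: three_graph_def V_def)
    then have finE: "finite (edges G)" by (intro finite_subset[of "edges G" "Pow V"]) auto
    have finF: "finite ?F" using finV by (intro finite_PiE) auto
    have cF: "card ?F = card V ^ N" by (simp add: card_funcsetE)
    have "4 * real N ^ 2 / \<epsilon> \<le> ?n" and n0: "0 < ?n" using n unfolding V_def by linarith+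
    then have n_large: "4 * real N ^ 2 \<le> \<epsilon> * ?n" using assms by (simp add: field_simps)
    have pN: "?n ^ N = ?n ^ 3 * ?n ^ (N - 3)" "?n ^ N = ?n * ?n ^ (N - 1)"
      using \<open>3 \<le> N\<close> by (simp_all flip: power_add power_Suc)
    \<comment> \<open>Markov's inequality: tuples outside \<open>L\<close> have at least q N^3
      ordered edges, while the average is at most (q - \<epsilon>/2) N^3.\<close>
    have "\<epsilon> / 2 * ?n ^ N \<le> real (card L)"
    proof -
      have "(?n ^ N - real (card L)) * (q * real N ^ 3) = real (card (?F - L)) * (q * real N ^ 3)"
        using finF by (subst card_Diff_subset) (auto simp: L_def cF card_mono of_nat_diff intro: finite_subset simp flip: cF)
      also have "\<dots> = (\<Sum>f\<in>?F - L. q * real N ^ 3)" by simp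
      also have "\<dots> \<le> (\<Sum>f\<in>?F - L. real (W f))"
      proof (rule sum_mono)
        fix f assume "f \<in> ?F - L"
        then have "\<not> real (W f) < q * real N ^ 3" unfolding L_def by blast
        then show "q * real N ^ 3 \<le> real (W f)" by (simp only: not_less)
      qed
      also have "\<dots> \<le> (\<Sum>f\<in>?F. real (W f))" using finF by (intro sum_mono2) auto
      also have "\<dots> = real (\<Sum>f\<in>?F. W f)" by simp
      also have "\<dots> \<le> real (N ^ 3 * (6 * card (edges G) * card V ^ (N - 3)))"
        using sum_sampled_edges[of "{..<N}" V "edges G"] finV finE E3 \<open>3 \<le> N\<close>
        unfolding W_def by (intro of_nat_mono) simp
      also have "\<dots> = real N ^ 3 * ?n ^ (N - 3) * (6 * real (card (edges G)))" by simp
      also have "\<dots> \<le> real N ^ 3 * ?n ^ (N - 3) * ((4 / 9 - \<epsilon>) * ?n ^ 3)"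
        using few unfolding V_def by (intro mult_left_mono) auto
      also have "\<dots> = ((q - \<epsilon> / 2) * ?n ^ N) * real N ^ 3" by (simp add: pN(1) q_def)
      finally have "((?n ^ N - real (card L)) * q) * real N ^ 3 \<le> ((q - \<epsilon> / 2) * ?n ^ N) * real N ^ 3"
        by (simp only: mult.assoc)
      then have "(?n ^ N - real (card L)) * q \<le> (q - \<epsilon> / 2) * ?n ^ N"
        using \<open>3 \<le> N\<close> by (simp only: mult_le_cancel_right) auto
      then have "\<epsilon> / 2 * ?n ^ N \<le> real (card L) * q" by (simp add: algebra_simps)
      also have "\<dots> \<le> real (card L) * 1" using \<open>q < 1\<close> by (intro mult_left_mono) auto
      finally show ?thesis by simp
    qed
    moreover have "real (card L) \<le> real (card P) + real N ^ 2 * ?n ^ (N - 1)"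
    proof -
      have "L \<subseteq> P \<union> {f \<in> ?F. \<not> inj_on f {..<N}}" by (auto simp: P_def L_def)
      then have "card L \<le> card (P \<union> {f \<in> ?F. \<not> inj_on f {..<N}})"
        using finF by (intro card_mono) (auto simp: P_def L_def)
      also have "\<dots> \<le> card P + card {f \<in> ?F. \<not> inj_on f {..<N}}" by (rule card_Un_le)
      also have "card {f \<in> ?F. \<not> inj_on f {..<N}} \<le> N ^ 2 * card V ^ (N - 1)"
        using card_non_injective[of "{..<N}" V] finV by simp
      finally have "real (card L) \<le> real (card P + N ^ 2 * card V ^ (N - 1))"
        by (simp only: of_nat_le_iff add_le_cancel_left)
      then show ?thesis by simp
    qed
    moreover have "real N ^ 2 * ?n ^ (N - 1) \<le> \<epsilon> / 4 * ?n ^ N"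
      using mult_right_mono[OF n_large, of "?n ^ (N - 1) / 4"] by (simp add: pN(2))
    ultimately have "\<epsilon> / 4 * ?n ^ N \<le> real (card P)" by linarith
    moreover have "P \<subseteq> ?F" by (auto simp: P_def L_def)
    moreover have "n1 \<le> card V" using n by (simp add: V_def)
    ultimately obtain X where X: "\<And>i. i < N \<Longrightarrow> X i \<subseteq> V \<and> card (X i) = m"
      and box: "Pi\<^sub>E {..<N} X \<subseteq> P"
      using n1[rule_format, of V P] finV by auto
    have "\<forall>i<N. card (X i) = m" using X by blast
    from clones[OF this, of "edges G"] obtain y where y: "\<forall>i<N. \<forall>a. y i a \<in> X i"
      and y_neq: "\<forall>i<N. y i False \<noteq> y i True"
      and u1: "\<forall>i<N. \<forall>j<N. \<forall>k<N. \<forall>a b c. i \<noteq> j \<longrightarrow> i \<noteq> k \<longrightarrow> j \<noteq> k \<longrightarrow>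
         ({y i a, y j b, y k c} \<in> edges G \<longleftrightarrow> {y i False, y j False, y k False} \<in> edges G)"
      and u2: "\<forall>i<N. \<forall>j<N. \<forall>b. i \<noteq> j \<longrightarrow>
         ({y i False, y i True, y j b} \<in> edges G \<longleftrightarrow> {y i False, y i True, y j False} \<in> edges G)"
      by (elim exE conjE) (rule that)
    note y = y[rule_format] and y_neq = y_neq[rule_format] and u1 = u1[rule_format] and u2 = u2[rule_format]
    have sel: "restrict (\<lambda>l. y l (s l)) {..<N} \<in> P" for s
      by (rule subsetD[OF box]) (simp add: restrict_PiE_iff y)
    have "i = j \<and> a = b" if "i < N" "j < N" "y i a = y j b" for i j a b
    proof (cases "i = j")
      case True
      then show ?thesis using that y_neq[of i] by (cases a; cases b) auto
    next
      case False
      have "inj_on (restrict (\<lambda>l. y l (if l = i then a else b)) {..<N}) {..<N}"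
        using sel[of "\<lambda>l. if l = i then a else b"] by (simp add: P_def)
      then show ?thesis using False that by (auto dest: inj_onD[of _ _ i j])
    qed
    note inj = this
    have "12 * M ^ 3 \<le> card {(i, j, k) \<in> {..<N} \<times> {..<N} \<times> {..<N}.
        {y i False, y j False, y k False} \<in> edges G} + 27 * M\<^sup>2"
    proof (rule clones_many_edges[OF G free _ \<open>0 < M\<close>])
      show "card {..<N} = 3 * M" by (simp add: N_def)
      show "y i a \<in> verts G" if "i \<in> {..<N}" for i a using y[of i a] X[of i] that V_def by auto
      show "i = j \<and> a = b" if "i \<in> {..<N}" "j \<in> {..<N}" "y i a = y j b" for i j a b
        using inj that by simp
      show "{y i a, y j b, y k c} \<in> edges G \<longleftrightarrow> {y i False, y j False, y k False} \<in> edges G"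
        if "i \<in> {..<N}" "j \<in> {..<N}" "k \<in> {..<N}" "i \<noteq> j" "i \<noteq> k" "j \<noteq> k" for i j k a b c
        by (rule u1) (use that in simp_all)
      show "{y i False, y i True, y j b} \<in> edges G \<longleftrightarrow> {y i False, y i True, y j False} \<in> edges G"
        if "i \<in> {..<N}" "j \<in> {..<N}" "i \<noteq> j" for i j b
        by (rule u2) (use that in simp_all)
    qed
    also have "card {(i, j, k) \<in> {..<N} \<times> {..<N} \<times> {..<N}. {y i False, y j False, y k False} \<in> edges G}
        = W (restrict (\<lambda>l. y l False) {..<N})"
      unfolding W_def by (intro arg_cong[where f = card]) auto
    finally have "12 * real M ^ 3 \<le> real (W (restrict (\<lambda>l. y l False) {..<N})) + 27 * real M ^ 2"
      by (simp flip: of_nat_power of_nat_mult of_nat_add)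
    also have "real (W (restrict (\<lambda>l. y l False) {..<N})) < q * real N ^ 3"
      using sel[of "\<lambda>_. False"] by (simp add: P_def L_def)
    also have "q * real N ^ 3 = 12 * real M ^ 3 - 27 / 2 * ((\<epsilon> * real M) * real M ^ 2)"
      by (simp add: N_def q_def power3_eq_cube power2_eq_square algebra_simps)
    finally have "(\<epsilon> * real M) * real M ^ 2 < 2 * real M ^ 2" by simp
    then show False using M_large \<open>0 < M\<close> by simp
  qed
qed

section \<open>The limit density\<close>

lemma real_choose_3: "real (n choose 3) = real n * (real n - 1) * (real n - 2) / 6"
  unfolding binomial_gbinomial gbinomial_prod_rev
  by (simp add: numeral_3_eq_3 fact_numeral)

text \<open>The Turan graph shows that the minimum is over a nonempty set, so \<open>ex_min\<close>
  is attained rather than unspecified.\<close>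

lemma ex_min_turan:
  fixes n :: nat
  defines "\<F> \<equiv> {I34, H1, H2, H3}"
  shows ex_min_attained: "\<exists>G :: nat hypergraph. three_graph G \<and> verts G = {1..n} \<and>
      induced_free \<F> G \<and> ex_min n \<F> = card (edges G)"
    and ex_min_le: "ex_min n \<F> \<le> card (edges (turan_graph n))"
proof -
  let ?S = "{card (edges G) | G :: nat hypergraph.
    three_graph G \<and> verts G = {1..n} \<and> induced_free \<F> G}"
  have "?S \<subseteq> {..2 ^ n}"
  proof clarify
    fix G :: "nat hypergraph" assume "three_graph G" "verts G = {1..n}"
    then have "edges G \<subseteq> Pow {1..n}" by (auto simp: three_graph_def)
    then have "card (edges G) \<le> card (Pow {1..n})" by (intro card_mono) auto
    then show "card (edges G) \<le> 2 ^ n" by (simp add: card_Pow)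
  qed
  then have fin: "finite ?S" by (rule finite_subset) simp
  have mem: "card (edges (turan_graph n)) \<in> ?S"
    using three_graph_turan_graph verts_turan_graph turan_graph_induced_free
    unfolding \<F>_def by blast
  show "\<exists>G :: nat hypergraph. three_graph G \<and> verts G = {1..n} \<and>
      induced_free \<F> G \<and> ex_min n \<F> = card (edges G)"
    using Min_in[OF fin] mem unfolding ex_min_def by blast
  show "ex_min n \<F> \<le> card (edges (turan_graph n))"
    using Min_le[OF fin mem] by (simp add: ex_min_def)
qed

lemma min_density_tendsto: "min_density {I34, H1, H2, H3} \<longlonglongrightarrow> 4 / 9"
proof (rule order_tendstoI)
  let ?e = "\<lambda>n. real (ex_min n {I34, H1, H2, H3})"
  fix a :: real assume "4 / 9 < a"
  have "(\<lambda>n. 12 * (real n / 3 + 1) ^ 3 / (real n * (real n - 1) * (real n - 2))) \<longlonglongrightarrow>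
      12 * (1 / 3) ^ 3"
    by real_asymp
  then have "(\<lambda>n. 12 * (real n / 3 + 1) ^ 3 / (real n * (real n - 1) * (real n - 2))) \<longlonglongrightarrow>
      4 / 9"
    by (simp add: power3_eq_cube)
  from order_tendstoD(2)[OF this \<open>4 / 9 < a\<close>]
  show "eventually (\<lambda>n. min_density {I34, H1, H2, H3} n < a) sequentially"
    using eventually_ge_at_top[of 3]
  proof eventually_elim
    case (elim n)
    have "6 * ex_min n {I34, H1, H2, H3} \<le> 12 * (n div 3 + 1) ^ 3"
      using ex_min_le[of n] card_edges_turan_graph[of n] by linarith
    then have "real (6 * ex_min n {I34, H1, H2, H3}) \<le> real (12 * (n div 3 + 1) ^ 3)"
      by (simp only: of_nat_le_iff)
    then have "6 * ?e n \<le> 12 * (real (n div 3) + 1) ^ 3" by (simp add: add.commute)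
    also have "\<dots> \<le> 12 * (real n / 3 + 1) ^ 3"
      using of_nat_div_le_of_nat[of n 3] by (intro mult_left_mono power_mono add_right_mono) auto
    finally have "6 * ?e n / (real n * (real n - 1) * (real n - 2)) \<le>
        12 * (real n / 3 + 1) ^ 3 / (real n * (real n - 1) * (real n - 2))"
      using elim by (intro divide_right_mono) auto
    then show ?case using elim(1) by (simp add: min_density_def real_choose_3 mult.commute)
  qed
next
  let ?e = "\<lambda>n. real (ex_min n {I34, H1, H2, H3})"
  fix a :: real assume "a < 4 / 9"
  \<comment> \<open>Half the gap to a, capped to keep \<epsilon> below 4/9 when a is very
    small.\<close>
  define \<epsilon> where "\<epsilon> = min ((4 / 9 - a) / 2) (1 / 9)"
  have \<epsilon>: "0 < \<epsilon>" "\<epsilon> < 4 / 9" "a < 4 / 9 - \<epsilon>" unfolding \<epsilon>_def using \<open>a < 4 / 9\<close> by (simp_all add: min_def field_simps)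
  obtain n0 where n0: "\<forall>G :: nat hypergraph. three_graph G \<and> induced_free {I34, H1, H2, H3} G \<and>
    n0 \<le> card (verts G) \<longrightarrow> (4 / 9 - \<epsilon>) * real (card (verts G)) ^ 3 \<le> 6 * real (card (edges G))"
    using eventually_many_edges[OF \<epsilon>(1,2)] by (elim exE)
  show "eventually (\<lambda>n. a < min_density {I34, H1, H2, H3} n) sequentially"
    using eventually_ge_at_top[of "max 3 n0"]
  proof eventually_elim
    case (elim n)
    have pos: "0 < real (n choose 3)" using elim by simp
    obtain G :: "nat hypergraph" where "three_graph G" "verts G = {1..n}"
      "induced_free {I34, H1, H2, H3} G" "ex_min n {I34, H1, H2, H3} = card (edges G)"
      using ex_min_attained[of n] by blast
    then have "(4 / 9 - \<epsilon>) * real n ^ 3 \<le> 6 * ?e n"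
      using n0[rule_format, of G] elim by simp
    moreover have "(4 / 9 - \<epsilon>) * (6 * real (n choose 3)) \<le> (4 / 9 - \<epsilon>) * real n ^ 3"
    proof (rule mult_left_mono)
      have "(real n - 1) * (real n - 2) \<le> real n * real n" using elim by (intro mult_mono) auto
      then have "real n * ((real n - 1) * (real n - 2)) \<le> real n * (real n * real n)"
        by (intro mult_left_mono) auto
      then show "6 * real (n choose 3) \<le> real n ^ 3"
        by (simp add: real_choose_3 power3_eq_cube mult.assoc)
    qed (use \<epsilon> in simp)
    ultimately have "(4 / 9 - \<epsilon>) * real (n choose 3) \<le> ?e n" by linarith
    then have "4 / 9 - \<epsilon> \<le> min_density {I34, H1, H2, H3} n"
      using pos by (simp add: min_density_def pos_le_divide_eq)
    then show ?case using \<epsilon>(3) by linarith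
  qed
qed

theorem theorem2p1:
  shows "convergent (min_density {I34, H1, H2, H3}) \<and> pi_min {I34, H1, H2, H3} = 4 / 9"
  unfolding pi_min_def using min_density_tendsto convergentI limI by blast

end
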